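(* With the data described in the context, assume: (a) there exist nonnegative measurable functions $\kappa_1,\kappa_2,\kappa_3,\kappa_4$ on $\Xi$ with $\mathbb{E}[\kappa_i(\xi)]<\infty$ ($i=1,2,3,4$) such that for all $z_1,z_2\in\mathbb{R}^n$, $|F(z_1,\xi)-F(z_2,\xi)|\le\kappa_1(\xi)\|z_1-z_2\|$ and $\|g(z_1,\xi)\|\le\kappa_2(\xi)\|z_1\|$ for a.e. $\xi\in\Xi$, and $\|M(\xi)\|\le\kappa_3(\xi)$, $\|q(\xi)\|\le\kappa_4(\xi)$ for all $\xi\in\Xi$; (b) $D\in\mathbb{R}^{l\times m}$ has full row rank with $l<m$, and the matrix $\mathcal{R}=[BY\;\;(A-BD^\dag C)BY\;\;(A-BD^\dag C)^2BY\;\cdots\;(A-BD^\dag C)^{n-1}BY]\in\mathbb{R}^{n\times n(m-l)}$ has full row rank, where $Y\in\mathbb{R}^{m\times(m-l)}$ is a matrix of full column rank $m-l$ with $DY=0$; (c) $\mathcal{B}(0,\beta\,\mathbb{E}[\kappa_2(\xi)]\,\|\mathbb{E}[q(\xi)]\|_1)\subseteq K$; (d) the set $\mathcal{V}=\{v\in\mathbb{R}^n:\ \mathbb{E}[M(\xi)v+q(\xi)]\ge 0,\ v\ge 0\}$ is nonempty; (e) $\mathbb{E}[M(\xi)]$ is an adequate matrix or a Z-matrix; (f) $\mathbb{E}[F(\cdot,\xi)]$ is bounded from below. Then for any $\epsilon>0$, the time-stepping problem (P$^{\epsilon,\nu}_h$) has an optimal solution for sufficiently large $\nu$ and sufficiently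 small $h$, with probability 1.
   Context: $\|\cdot\|$ is the Euclidean norm of a vector and a matrix; $\|\cdot\|_1$ is the 1-norm. $L^2(0,T)^n$ is the space of square integrable functions $(0,T)\to\mathbb{R}^n$. $\mathcal{B}(v,\varepsilon)=\{w:\|w-v\|\le\varepsilon\}$; $\mathrm{dist}(z,K)=\inf_{z'\in K}\|z-z'\|$; $K^\epsilon=\{z:\mathrm{dist}(z,K)\le\epsilon\}$. $D^\dag$ is the pseudoinverse of $D$ ($D^\dag=D^\top(DD^\top)^{-1}$ when $D$ has full row rank). Vector inequalities and $\min$ of vectors are componentwise. Data: $\xi$ is a random variable on a probability space $(\Omega,\mathcal{F},\mathcal{P})$ with support $\Xi=\xi(\Omega)\subseteq\mathbb{R}^d$, and $\xi_1,\dots,\xi_\nu$ is an i.i.d. sample of $\xi$. $A\in\mathbb{R}^{n\times n}$, $B\in\mathbb{R}^{n\times m}$, $C\in\mathbb{R}^{l\times n}$, $D\in\mathbb{R}^{l\times m}$, $x_0\in\mathbb{R}^n$, $f\in L^2(0,T)^l$, $\delta>0$, $x_d\in L^2(0,T)^n$, $u_d\in L^2(0,T)^m$; $K\subseteq\mathbb{R}^{\ell}$ is nonempty, closed, convex. $F:\mathbb{R}^n\times\Xi\to\mathbb{R}$ and $g:\mathbb{R}^n\times\Xi\to\mathbb{R}^{\ell}$ are continuously differentiable in the first variable for a.e. $\xi\in\Xi$ and measurable in $\xi$ for each first argument; $M:\Xi\to\mathbb{R}^{n\times n}$ and $q:\Xi\to\mathbb{R}^n$ are measurable. Time-stepping: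 for a positive integer $N$, $h=T/N=t_{i+1}-t_i$, $i=0,\dots,N-1$, with $t_0=0$; $x_{d,i}=x_d(t_i)$, $u_{d,i}=u_d(t_i)$, $f_i=f(t_i)$. Problem (P$^{\epsilon,\nu}_h$): with $\mathbf{x}_0=x_0$, minimize over $\{\mathbf{x}_i,\mathbf{u}_i\}_{i=1}^N$, $\mathbf{x}_i\in\mathbb{R}^n$, $\mathbf{u}_i\in\mathbb{R}^m$, $$\frac1\nu\sum_{j=1}^\nu F(\mathbf{x}_N,\xi_j)+\frac h2\sum_{i=1}^N\big(\|\mathbf{x}_i-x_{d,i}\|^2+\delta\|\mathbf{u}_i-u_{d,i}\|^2\big)$$ subject to $\mathbf{x}_{i+1}-\mathbf{x}_i=hA\mathbf{x}_{i+1}+hB\mathbf{u}_{i+1}$ and $C\mathbf{x}_{i+1}+D\mathbf{u}_{i+1}-f_{i+1}\le0$ for $i=0,\dots,N-1$; $\left\|\min\{\mathbf{x}_N,\frac1\nu\sum_{j=1}^\nu[M(\xi_j)\mathbf{x}_N+q(\xi_j)]\}\right\|\le\epsilon$; $\frac1\nu\sum_{j=1}^\nu g(\mathbf{x}_N,\xi_j)\in K^\epsilon$. For $J\subseteq\{1,\dots,n\}$ nonempty, $\mathbb{E}[M_{J,J}(\xi)]$ is the principal submatrix of $\mathbb{E}[M(\xi)]$ with rows and columns in $J$. Let $\mathcal{J}=\{J:\mathbb{E}[M_{J,J}(\xi)]\text{ is nonsingular}\}$; $\beta=1$ if $\mathcal{J}=\emptyset$, and $\beta=\max\{\|(\mathbb{E}[M_{J,J}(\xi)])^{-1}\|_1: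 J\in\mathcal{J}\}$ otherwise. A square matrix is a Z-matrix if its off-diagonal entries are non-positive. A matrix $N\in\mathbb{R}^{n\times n}$ is column adequate if for each $z\in\mathbb{R}^n$, $z_i(Nz)_i\le 0$ for all $i$ implies $Nz=0$; row adequate if $N^\top$ is column adequate; adequate if both. *)

theory Defs
  imports "HOL-Probability.Probability"
begin

section \<open>Vectors and matrices\<close>

definition vec_norm1 :: "real^'n \<Rightarrow> real" where
  "vec_norm1 v = (\<Sum>i\<in>UNIV. \<bar>v $ i\<bar>)"

text \<open>The matrix norm induced by \<^const>\<open>vec_norm1\<close>, i.e. the maximal absolute column sum.\<close>

definition mat_norm1 :: "real^'n^'m \<Rightarrow> real" where
  "mat_norm1 A = Max (range (\<lambda>j. \<Sum>i\<in>UNIV. \<bar>A $ i $ j\<bar>))"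

definition vec_min :: "real^'n \<Rightarrow> real^'n \<Rightarrow> real^'n" where
  "vec_min v w = (\<chi> i. min (v $ i) (w $ i))"

text \<open>The overloaded power on \<^typ>\<open>real^'n^'n\<close> is componentwise, hence a separate definition.\<close>

definition mat_pow :: "real^'n^'n \<Rightarrow> nat \<Rightarrow> real^'n^'n" where
  "mat_pow A k = (((**) A) ^^ k) (mat 1)"

text \<open>The Moore--Penrose pseudoinverse, characterised by the four Penrose equations.\<close>

definition penrose_inverse :: "real^'m^'l \<Rightarrow> real^'l^'m \<Rightarrow> bool" where
  "penrose_inverse D X \<longleftrightarrow>
     D ** X ** D = D \<and> X ** D ** X = X \<and>
     transpose (D ** X) = D ** X \<and> transpose (X ** D) = X ** D"

definition pseudoinverse :: "real^'m^'l \<Rightarrow> real^'l^'m" where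
  "pseudoinverse D = (THE X. penrose_inverse D X)"

lemma penrose_inverse_unique:
  assumes "penrose_inverse D X" "penrose_inverse D Z"
  shows "X = Z"
proof -
  have x: "D ** X ** D = D" "X ** D ** X = X"
      "transpose (D ** X) = D ** X" "transpose (X ** D) = X ** D"
    and z: "D ** Z ** D = D" "Z ** D ** Z = Z"
      "transpose (D ** Z) = D ** Z" "transpose (Z ** D) = Z ** D"
    using assms by (auto simp: penrose_inverse_def)
  have "D ** X = transpose (D ** Z ** (D ** X))"
    using x z by (metis matrix_mul_assoc)
  also have "\<dots> = (D ** X) ** (D ** Z)"
    by (simp only: matrix_transpose_mul[of "D ** Z" "D ** X"] x z)
  also have "\<dots> = D ** Z"
    using x by (simp add: matrix_mul_assoc)
  finally have DX: "D ** X = D ** Z" .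
  have "X ** D = transpose ((X ** D) ** (Z ** D))"
    using x z by (metis matrix_mul_assoc)
  also have "\<dots> = (Z ** D) ** (X ** D)"
    by (simp only: matrix_transpose_mul[of "X ** D" "Z ** D"] x z)
  also have "\<dots> = Z ** D"
    using x by (metis matrix_mul_assoc)
  finally have XD: "X ** D = Z ** D" .
  have "X = X ** D ** X" using x by simp
  also have "\<dots> = Z ** D ** Z" using DX XD by (metis matrix_mul_assoc)
  finally show ?thesis using z by simp
qed

lemma pseudoinverse_full_row_rank:
  fixes D :: "real^'m^'l"
  assumes "rank D = CARD('l)"
  shows "pseudoinverse D = transpose D ** matrix_inv (D ** transpose D)"
proof -
  let ?G = "D ** transpose D" and ?X = "transpose D ** matrix_inv (D ** transpose D)"
  have "rank (transpose D) = CARD('l)" using assms by (simp add: rank_transpose)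
  then have inj: "inj ((*v) (transpose D))" by (simp add: full_rank_injective)
  have "x = 0" if "?G *v x = 0" for x
  proof -
    have "inner (transpose D *v x) (transpose D *v x) = inner x (?G *v x)"
      unfolding matrix_vector_mul_assoc[symmetric] dot_lmul_matrix[symmetric]
      by simp
    then have "transpose D *v x = transpose D *v 0" using that by simp
    then show ?thesis using inj by (meson injD)
  qed
  then have inv: "invertible ?G"
    by (metis invertible_left_inverse matrix_left_invertible_ker)
  then have G: "?G ** matrix_inv ?G = mat 1" "matrix_inv ?G ** ?G = mat 1"
    unfolding invertible_def matrix_inv_def by (metis (mono_tags, lifting) someI_ex)+
  have "transpose (matrix_inv ?G) = matrix_inv ?G"
  proof -
    have s: "transpose ?G = ?G" by (simp add: matrix_transpose_mul)
    have "transpose (matrix_inv ?G) ** ?G = mat 1"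
      by (metis G(1) matrix_transpose_mul s transpose_mat)
    then show ?thesis
      by (metis G(1) matrix_mul_assoc matrix_mul_lid matrix_mul_rid)
  qed
  moreover have "D ** ?X = mat 1" using G by (simp add: matrix_mul_assoc)
  ultimately have "penrose_inverse D ?X"
    unfolding penrose_inverse_def
    by (simp add: matrix_mul_assoc[symmetric] matrix_transpose_mul)
  then show ?thesis
    unfolding pseudoinverse_def using penrose_inverse_unique by (metis the_equality)
qed

text \<open>
  The block matrix \<open>[G, H G, \<dots>, H^(n-1) G]\<close>, where \<open>n\<close> is the cardinality of \<open>'n\<close>. Its columns are
  indexed by pairs (block, column inside the block); \<open>to_nat_on UNIV\<close> is a bijection from the
  finite type \<open>'n\<close> onto \<open>{..<n}\<close> that serves to number the blocks.
\<close>

definition krylov_matrix :: "real^'n^'n \<Rightarrow> real^'k^'n \<Rightarrow> real^('n \<times> 'k)^'n" where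
  "krylov_matrix H G =
     (\<chi> r c. (mat_pow H (to_nat_on (UNIV :: 'n set) (fst c)) ** G) $ r $ snd c)"

definition Z_matrix :: "real^'n^'n \<Rightarrow> bool" where
  "Z_matrix A \<longleftrightarrow> (\<forall>i j. i \<noteq> j \<longrightarrow> A $ i $ j \<le> 0)"

definition column_adequate :: "real^'n^'n \<Rightarrow> bool" where
  "column_adequate A \<longleftrightarrow> (\<forall>z. (\<forall>i. z $ i * (A *v z) $ i \<le> 0) \<longrightarrow> A *v z = 0)"

definition row_adequate :: "real^'n^'n \<Rightarrow> bool" where
  "row_adequate A \<longleftrightarrow> column_adequate (transpose A)"

definition adequate :: "real^'n^'n \<Rightarrow> bool" where
  "adequate A \<longleftrightarrow> column_adequate A \<and> row_adequate A"


section \<open>Principal submatrices\<close>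

text \<open>
  A matrix with rows and columns in \<open>J\<close> is represented by its extension by zero to all indices.
  \<open>is_principal_inverse A J X\<close> says that \<open>X\<close> represents the two-sided inverse of the principal
  submatrix of \<open>A\<close> with rows and columns in \<open>J\<close>. The zero columns outside \<open>J\<close> do not affect
  \<^const>\<open>mat_norm1\<close>.
\<close>

definition is_principal_inverse :: "real^'n^'n \<Rightarrow> 'n set \<Rightarrow> real^'n^'n \<Rightarrow> bool" where
  "is_principal_inverse A J X \<longleftrightarrow>
     (\<forall>i j. i \<notin> J \<or> j \<notin> J \<longrightarrow> X $ i $ j = 0) \<and>
     (\<forall>i\<in>J. \<forall>j\<in>J. (\<Sum>k\<in>J. A $ i $ k * X $ k $ j) = (if i = j then 1 else 0)) \<and>
     (\<forall>i\<in>J. \<forall>j\<in>J. (\<Sum>k\<in>J. X $ i $ k * A $ k $ j) = (if i = j then 1 else 0))"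

definition principal_nonsingular :: "real^'n^'n \<Rightarrow> 'n set \<Rightarrow> bool" where
  "principal_nonsingular A J \<longleftrightarrow> (\<exists>X. is_principal_inverse A J X)"

definition principal_inv :: "real^'n^'n \<Rightarrow> 'n set \<Rightarrow> real^'n^'n" where
  "principal_inv A J = (THE X. is_principal_inverse A J X)"

lemma is_principal_inverse_unique:
  assumes "is_principal_inverse A J X" "is_principal_inverse A J Z"
  shows "X = Z"
proof -
  have "X $ i $ j = Z $ i $ j" for i j
  proof (cases "i \<in> J \<and> j \<in> J")
    case True
    have "X $ i $ j = (\<Sum>k\<in>J. X $ i $ k * (if k = j then 1 else 0))"
      using True by (simp add: if_distrib cong: if_cong)
    also have "\<dots> = (\<Sum>k\<in>J. X $ i $ k * (\<Sum>m\<in>J. A $ k $ m * Z $ m $ j))"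
      using True assms(2) by (intro sum.cong) (auto simp: is_principal_inverse_def)
    also have "\<dots> = (\<Sum>k\<in>J. \<Sum>m\<in>J. X $ i $ k * A $ k $ m * Z $ m $ j)"
      by (simp add: sum_distrib_left mult.assoc)
    also have "\<dots> = (\<Sum>m\<in>J. (\<Sum>k\<in>J. X $ i $ k * A $ k $ m) * Z $ m $ j)"
      by (subst sum.swap) (simp add: sum_distrib_right)
    also have "\<dots> = (\<Sum>m\<in>J. (if i = m then 1 else 0) * Z $ m $ j)"
      using True assms(1) by (intro sum.cong) (auto simp: is_principal_inverse_def)
    also have "\<dots> = (\<Sum>m\<in>J. if i = m then Z $ m $ j else 0)"
      by (intro sum.cong) auto
    also have "\<dots> = Z $ i $ j"
      using True by simp
    finally show ?thesis .
  next
    case False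
    then show ?thesis using assms by (auto simp: is_principal_inverse_def)
  qed
  then show ?thesis by (simp add: vec_eq_iff)
qed

lemma principal_inv_eq: "is_principal_inverse A J X \<Longrightarrow> principal_inv A J = X"
  unfolding principal_inv_def by (blast intro: is_principal_inverse_unique the_equality)

definition nonsingular_index_sets :: "real^'n^'n \<Rightarrow> 'n set set" where
  "nonsingular_index_sets A = {J. J \<noteq> {} \<and> principal_nonsingular A J}"

definition beta_const :: "real^'n^'n \<Rightarrow> real" where
  "beta_const A =
     (if nonsingular_index_sets A = {} then 1
      else Max ((\<lambda>J. mat_norm1 (principal_inv A J)) ` nonsingular_index_sets A))"


section \<open>Function spaces\<close>

definition square_integrable :: "real \<Rightarrow> (real \<Rightarrow> real^'n) \<Rightarrow> bool" where
  "square_integrable T f \<longleftrightarrow>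
     set_borel_measurable lebesgue {0<..<T} f \<and>
     set_integrable lebesgue {0<..<T} (\<lambda>t. (norm (f t))\<^sup>2)"

definition continuously_differentiable ::
    "('a::real_normed_vector \<Rightarrow> 'b::real_normed_vector) \<Rightarrow> bool" where
  "continuously_differentiable f \<longleftrightarrow>
     (\<exists>f' :: 'a \<Rightarrow> 'a \<Rightarrow>\<^sub>L 'b.
        (\<forall>z. (f has_derivative blinfun_apply (f' z)) (at z)) \<and> continuous_on UNIV f')"


section \<open>The sample average time-stepping problem\<close>

text \<open>
  In this section \<open>s j\<close> is the \<open>j\<close>-th sample point, \<open>j = 1, 2, \<dots>\<close>; the horizon is \<open>T\<close> and there
  are \<open>N\<close> steps of length \<open>T / N\<close>. A candidate is a pair \<open>(x, u)\<close> of which only \<open>x 0, \<dots>, x N\<close> and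
  \<open>u 1, \<dots>, u N\<close> matter; \<open>x 0\<close> is fixed by feasibility.
\<close>

definition sample_average :: "nat \<Rightarrow> (nat \<Rightarrow> 'd) \<Rightarrow> ('d \<Rightarrow> 'a::real_vector) \<Rightarrow> 'a" where
  "sample_average \<nu> s \<phi> = (1 / real \<nu>) *\<^sub>R (\<Sum>j=1..\<nu>. \<phi> (s j))"

definition time_stepping_objective ::
    "(real^'n \<Rightarrow> real^'d \<Rightarrow> real) \<Rightarrow> (real \<Rightarrow> real^'n) \<Rightarrow> (real \<Rightarrow> real^'m) \<Rightarrow> real \<Rightarrow>
     real \<Rightarrow> nat \<Rightarrow> nat \<Rightarrow> (nat \<Rightarrow> real^'d) \<Rightarrow>
     (nat \<Rightarrow> real^'n) \<times> (nat \<Rightarrow> real^'m) \<Rightarrow> real" where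
  "time_stepping_objective F xd ud \<delta> T N \<nu> s = (\<lambda>(x, u).
     let h = T / real N in
       sample_average \<nu> s (F (x N)) +
       h / 2 * (\<Sum>i=1..N. (norm (x i - xd (real i * h)))\<^sup>2 +
                          \<delta> * (norm (u i - ud (real i * h)))\<^sup>2))"

definition time_stepping_feasible ::
    "real^'n^'n \<Rightarrow> real^'m^'n \<Rightarrow> real^'n^'l \<Rightarrow> real^'m^'l \<Rightarrow> real^'n \<Rightarrow> (real \<Rightarrow> real^'l) \<Rightarrow>
     (real^'d \<Rightarrow> real^'n^'n) \<Rightarrow> (real^'d \<Rightarrow> real^'n) \<Rightarrow>
     (real^'n \<Rightarrow> real^'d \<Rightarrow> real^'p) \<Rightarrow> (real^'p) set \<Rightarrow>
     real \<Rightarrow> real \<Rightarrow> nat \<Rightarrow> nat \<Rightarrow> (nat \<Rightarrow> real^'d) \<Rightarrow>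
     (nat \<Rightarrow> real^'n) \<times> (nat \<Rightarrow> real^'m) \<Rightarrow> bool" where
  "time_stepping_feasible A B C D x0 f M q g K \<epsilon> T N \<nu> s = (\<lambda>(x, u).
     let h = T / real N in
       x 0 = x0 \<and>
       (\<forall>i<N. x (Suc i) - x i = h *\<^sub>R (A *v x (Suc i)) + h *\<^sub>R (B *v u (Suc i)) \<and>
              C *v x (Suc i) + D *v u (Suc i) - f (real (Suc i) * h) \<le> 0) \<and>
       norm (vec_min (x N) (sample_average \<nu> s (\<lambda>\<xi>. M \<xi> *v x N + q \<xi>))) \<le> \<epsilon> \<and>
       infdist (sample_average \<nu> s (g (x N))) K \<le> \<epsilon>)"

definition time_stepping_optimal ::
    "real^'n^'n \<Rightarrow> real^'m^'n \<Rightarrow> real^'n^'l \<Rightarrow> real^'m^'l \<Rightarrow> real^'n \<Rightarrow> (real \<Rightarrow> real^'l) \<Rightarrow>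
     (real \<Rightarrow> real^'n) \<Rightarrow> (real \<Rightarrow> real^'m) \<Rightarrow> real \<Rightarrow>
     (real^'n \<Rightarrow> real^'d \<Rightarrow> real) \<Rightarrow> (real^'d \<Rightarrow> real^'n^'n) \<Rightarrow> (real^'d \<Rightarrow> real^'n) \<Rightarrow>
     (real^'n \<Rightarrow> real^'d \<Rightarrow> real^'p) \<Rightarrow> (real^'p) set \<Rightarrow>
     real \<Rightarrow> real \<Rightarrow> nat \<Rightarrow> nat \<Rightarrow> (nat \<Rightarrow> real^'d) \<Rightarrow>
     (nat \<Rightarrow> real^'n) \<times> (nat \<Rightarrow> real^'m) \<Rightarrow> bool" where
  "time_stepping_optimal A B C D x0 f xd ud \<delta> F M q g K \<epsilon> T N \<nu> s =
     is_arg_min (time_stepping_objective F xd ud \<delta> T N \<nu> s)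
       (time_stepping_feasible A B C D x0 f M q g K \<epsilon> T N \<nu> s)"

end

theory Submission
  imports Defs
begin

text \<open>
  The expected complementarity problem has a solution \<open>x\<close> with \<open>\<parallel>x\<parallel>\<^sub>1 \<le> \<beta> \<parallel>E[q]\<parallel>\<^sub>1\<close>, namely one whose
  support carries a nonsingular principal submatrix; hence \<open>E[g(x,\<xi>)]\<close> lies in the ball contained
  in \<open>K\<close>. By the strong law of large numbers, applied at this single point, \<open>x\<close> satisfies the relaxed
  terminal constraints of the sampled problem for all large \<open>\<nu>\<close>, almost surely. The rank
  condition makes the scheme with at least \<open>n\<close> steps exactly controllable while \<open>C x + D u = f\<close> is
  kept, so some trajectory ends in \<open>x\<close> and the problem is feasible. For a fixed step size the tracking
  term is coercive, so a minimiser exists by compactness.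
\<close>

section \<open>Linear complementarity problems\<close>

text \<open>Hypothesis (c) measures the ball inside \<open>K\<close> by \<beta>, and \<beta> only
  sees inverses of nonsingular principal submatrices. An arbitrary solution may be too large, so one
  is sought that is determined by its support equations x_J = -(M_JJ)^{-1} q_J. For a Z-matrix the
  least feasible point is of this kind. For an adequate matrix feasibility gives no direct existence
  argument: \<open>q\<close> is perturbed to reach strict feasibility, and only the norm bound, not
  the nonsingularity of the support, has to survive the limit.

  The target x is fixed before sampling, so no uniform convergence of averages enters; \<epsilon>
  absorbs the sampling error at x. Trajectories hit x exactly, so discretisation adds no error and
  the threshold for the step size is the deterministic T/n, while the threshold for \<nu> depends on
  the sample.\<close>

definition lcp_solution :: "real^'n^'n \<Rightarrow> real^'n \<Rightarrow> real^'n \<Rightarrow> bool" where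
  "lcp_solution M q x \<longleftrightarrow> (\<forall>i. 0 \<le> x$i \<and> 0 \<le> (M *v x + q)$i \<and> x$i * (M *v x + q)$i = 0)"

text \<open>The principal submatrix indexed by the support of \<open>x\<close> is nonsingular.\<close>

definition nondegenerate_support :: "real^'n^'n \<Rightarrow> real^'n \<Rightarrow> bool" where
  "nondegenerate_support M x \<longleftrightarrow>
     (\<forall>z. (\<forall>i. x$i = 0 \<longrightarrow> z$i = 0) \<longrightarrow> (\<forall>i. x$i \<noteq> 0 \<longrightarrow> (M *v z)$i = 0) \<longrightarrow> z = 0)"

section \<open>The 1-norm and the constant \<beta>\<close>

lemma vec_norm1_nonneg: "0 \<le> vec_norm1 v"
  by (simp add: vec_norm1_def sum_nonneg)

lemma norm_le_vec_norm1: "norm (v :: real^'n) \<le> vec_norm1 v"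
  unfolding vec_norm1_def by (rule norm_le_l1_cart)

lemma tendsto_vec_norm1 [tendsto_intros]:
  "(f \<longlongrightarrow> l) F \<Longrightarrow> ((\<lambda>x. vec_norm1 (f x)) \<longlongrightarrow> vec_norm1 l) F"
  unfolding vec_norm1_def by (intro tendsto_intros)

lemma column_sum_le_mat_norm1: "(\<Sum>i\<in>UNIV. \<bar>A$i$j\<bar>) \<le> mat_norm1 A"
  unfolding mat_norm1_def by (intro Max_ge) auto

lemma mat_norm1_nonneg: "0 \<le> mat_norm1 A"
  by (rule order_trans[OF _ column_sum_le_mat_norm1[of A undefined]]) (simp add: sum_nonneg)

lemma vec_norm1_matrix_vector_mult: "vec_norm1 (A *v y) \<le> mat_norm1 A * vec_norm1 y"
proof -
  have "vec_norm1 (A *v y) \<le> (\<Sum>i\<in>UNIV. \<Sum>j\<in>UNIV. \<bar>A$i$j\<bar> * \<bar>y$j\<bar>)"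
    unfolding vec_norm1_def matrix_vector_mult_def
    by (auto intro!: sum_mono order_trans[OF sum_abs] simp: abs_mult)
  also have "\<dots> = (\<Sum>j\<in>UNIV. (\<Sum>i\<in>UNIV. \<bar>A$i$j\<bar>) * \<bar>y$j\<bar>)"
    by (subst sum.swap) (simp add: sum_distrib_right)
  also have "\<dots> \<le> (\<Sum>j\<in>UNIV. mat_norm1 A * \<bar>y$j\<bar>)"
    by (intro sum_mono mult_right_mono column_sum_le_mat_norm1) auto
  finally show ?thesis by (simp add: vec_norm1_def sum_distrib_left)
qed

lemma finite_nonsingular_index_sets: "finite (nonsingular_index_sets A)"
  by (rule finite_subset[of _ "Pow UNIV"]) auto

lemma mat_norm1_principal_inv_le_beta:
  "J \<in> nonsingular_index_sets A \<Longrightarrow> mat_norm1 (principal_inv A J) \<le> beta_const A"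
  unfolding beta_const_def using finite_nonsingular_index_sets[of A]
  by (auto intro!: Max_ge)

lemma beta_const_nonneg: "0 \<le> beta_const A"
proof (cases "nonsingular_index_sets A = {}")
  case False
  then obtain J where "J \<in> nonsingular_index_sets A" by auto
  then show ?thesis
    using mat_norm1_nonneg mat_norm1_principal_inv_le_beta order_trans by blast
qed (simp add: beta_const_def)

text \<open>The principal submatrix is completed to a full matrix \<open>A'\<close> by the identity
  outside \<open>J\<close>. A vector killed by \<open>A'\<close> vanishes outside \<open>J\<close>
  and then satisfies the hypothesis, so \<open>A'\<close> is invertible; the \<open>J\<close>-block
  of its inverse is the inverse sought.\<close>

lemma principal_nonsingularI:
  fixes A :: "real^'n^'n"
  assumes "\<And>z. (\<And>i. i \<notin> J \<Longrightarrow> z$i = 0) \<Longrightarrow> (\<And>i. i \<in> J \<Longrightarrow> (A *v z)$i = 0) \<Longrightarrow> z = 0"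
  shows "principal_nonsingular A J"
proof -
  define A' :: "real^'n^'n"
    where "A' = (\<chi> i j. if i \<in> J \<and> j \<in> J then A$i$j else if i = j then 1 else 0)"
  have on: "(A' *v z)$i = (\<Sum>k\<in>J. A$i$k * z$k)" if "i \<in> J" for i z
    unfolding A'_def matrix_vector_mult_def using that
    by (auto intro!: sum.mono_neutral_cong_right)
  have off: "(A' *v z)$i = z$i" if "i \<notin> J" for i z
    using that by (simp add: A'_def matrix_vector_mult_def mult_delta_left)
  have "z = 0" if "A' *v z = 0" for z
  proof (rule assms)
    show z: "z$i = 0" if "i \<notin> J" for i
      using off[OF that, of z] \<open>A' *v z = 0\<close> by simp
    show "(A *v z)$i = 0" if "i \<in> J" for i
    proof -
      have "(A *v z)$i = (\<Sum>k\<in>J. A$i$k * z$k)"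
        unfolding matrix_vector_mult_def using z by (auto intro!: sum.mono_neutral_right)
      then show ?thesis using on[OF that, of z] \<open>A' *v z = 0\<close> by simp
    qed
  qed
  then obtain X' where X': "X' ** A' = mat 1" "A' ** X' = mat 1"
    by (metis matrix_left_invertible_ker matrix_left_right_inverse)
  define X :: "real^'n^'n" where "X = (\<chi> i j. if i \<in> J \<and> j \<in> J then X'$i$j else 0)"
  have "(\<Sum>k\<in>J. A$i$k * X$k$j) = (A' ** X')$i$j" if "i \<in> J" "j \<in> J" for i j
    unfolding matrix_matrix_mult_def A'_def X_def using that
    by (auto intro!: sum.mono_neutral_cong_left)
  moreover have "(\<Sum>k\<in>J. X$i$k * A$k$j) = (X' ** A')$i$j" if "i \<in> J" "j \<in> J" for i j
    unfolding matrix_matrix_mult_def A'_def X_def using that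
    by (auto intro!: sum.mono_neutral_cong_left)
  ultimately have "is_principal_inverse A J X"
    unfolding is_principal_inverse_def X' by (auto simp: X_def mat_def)
  then show ?thesis unfolding principal_nonsingular_def by blast
qed

text \<open>Complementarity makes the residual vanish on the support \<open>J\<close>, so M_JJ x_J =
  -q_J is solved by the zero-extended inverse. The case x = 0 is separate because
  \<open>nonsingular_index_sets\<close> excludes the empty set.\<close>

lemma lcp_solution_norm_le:
  fixes M :: "real^'n^'n"
  assumes sol: "lcp_solution M q x" and nd: "nondegenerate_support M x"
  shows "vec_norm1 x \<le> beta_const M * vec_norm1 q"
proof (cases "x = 0")
  case True
  then show ?thesis
    by (simp add: vec_norm1_def[of "0::real^'n"] beta_const_nonneg vec_norm1_nonneg)
next
  case False
  define J where "J = {i. x$i \<noteq> 0}"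
  define X where "X = principal_inv M J"
  have "principal_nonsingular M J"
    using nd unfolding nondegenerate_support_def J_def by (intro principal_nonsingularI) auto
  moreover have "J \<noteq> {}" using False by (auto simp: J_def vec_eq_iff)
  ultimately have J: "J \<in> nonsingular_index_sets M" by (simp add: nonsingular_index_sets_def)
  have X: "is_principal_inverse M J X"
    using \<open>principal_nonsingular M J\<close> principal_inv_eq
    unfolding principal_nonsingular_def X_def by metis
  have "x$i = (X *v (- q))$i" for i
  proof (cases "i \<in> J")
    case True
    have q: "- q$k = (\<Sum>j\<in>J. M$k$j * x$j)" if "k \<in> J" for k
    proof -
      have "(M *v x)$k + q$k = 0"
        using sol that by (auto simp: lcp_solution_def J_def)
      moreover have "(M *v x)$k = (\<Sum>j\<in>J. M$k$j * x$j)"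
        unfolding matrix_vector_mult_def J_def by (auto intro!: sum.mono_neutral_right)
      ultimately show ?thesis by simp
    qed
    have "(X *v (- q))$i = (\<Sum>k\<in>J. X$i$k * (- q$k))"
      unfolding matrix_vector_mult_def using X
      by (auto intro!: sum.mono_neutral_right simp: is_principal_inverse_def)
    also have "\<dots> = (\<Sum>k\<in>J. \<Sum>j\<in>J. X$i$k * M$k$j * x$j)"
      by (intro sum.cong) (simp_all add: q sum_distrib_left mult.assoc)
    also have "\<dots> = (\<Sum>j\<in>J. (\<Sum>k\<in>J. X$i$k * M$k$j) * x$j)"
      by (subst sum.swap) (simp add: sum_distrib_right)
    also have "\<dots> = (\<Sum>j\<in>J. if i = j then x$j else 0)"
      using X True by (intro sum.cong) (auto simp: is_principal_inverse_def)
    finally show ?thesis using True by simp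
  next
    case False
    then show ?thesis
      using X by (simp add: J_def is_principal_inverse_def matrix_vector_mult_def)
  qed
  then have "x = X *v (- q)" by (simp add: vec_eq_iff)
  then have "vec_norm1 x \<le> mat_norm1 X * vec_norm1 q"
    using vec_norm1_matrix_vector_mult[of X "- q"] by (simp add: vec_norm1_def)
  also have "\<dots> \<le> beta_const M * vec_norm1 q"
    unfolding X_def by (intro mult_right_mono mat_norm1_principal_inv_le_beta J vec_norm1_nonneg)
  finally show ?thesis .
qed

section \<open>Solutions with nonsingular support\<close>

text \<open>The minimum ratio rule of the simplex method: the longest step along \<open>z\<close>
  that keeps all coordinates nonnegative, blocked by coordinate \<open>i\<close>. The support
  condition makes the step positive.\<close>

lemma ratio_test:
  fixes x z :: "real^'n"
  assumes x: "\<And>i. 0 \<le> x$i" and supp: "\<And>i. x$i = 0 \<Longrightarrow> z$i = 0" and neg: "\<exists>i. z$i < 0"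
  obtains t i where "t > 0" "\<And>i. 0 \<le> x$i + t * z$i" "x$i + t * z$i = 0" "x$i > 0" "z$i < 0"
proof -
  define I where "I = {i. z$i < 0}"
  obtain i where i: "i \<in> I" "\<And>j. j \<in> I \<Longrightarrow> x$i / (- z$i) \<le> x$j / (- z$j)"
    using ex_min_if_finite[of "(\<lambda>i. x$i / (- z$i)) ` I"] neg
    by (auto simp: I_def) (metis not_less)
  define t where "t = x$i / (- z$i)"
  have xi: "x$i > 0" using i(1) supp[of i] x[of i] by (auto simp: I_def less_le)
  show ?thesis
  proof
    show t: "t > 0" using xi i(1) by (auto simp: t_def I_def divide_pos_neg field_simps)
    show "0 \<le> x$j + t * z$j" for j
    proof (cases "j \<in> I")
      case True
      then have "t * (- z$j) \<le> x$j" using i(2)[OF True] unfolding t_def[symmetric] I_def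
        by (subst pos_le_divide_eq[symmetric]) auto
      then show ?thesis by simp
    next
      case False
      then show ?thesis using x[of j] t by (simp add: I_def not_less)
    qed
    show "x$i + t * z$i = 0" using i(1) by (simp add: t_def I_def)
    show "x$i > 0" by fact
    show "z$i < 0" using i(1) by (simp add: I_def)
  qed
qed

text \<open>A degenerate direction may be replaced by its negative, so the negative coordinate that
  \<open>ratio_test\<close> asks for can always be arranged.\<close>

lemma not_nondegenerate_support:
  fixes x :: "real^'n"
  assumes "\<not> nondegenerate_support M x"
  obtains z where "\<And>i. x$i = 0 \<Longrightarrow> z$i = 0" "\<And>i. x$i \<noteq> 0 \<Longrightarrow> (M *v z)$i = 0" "\<exists>i. z$i < 0"
proof -
  obtain z where z: "\<And>i. x$i = 0 \<Longrightarrow> z$i = 0" "\<And>i. x$i \<noteq> 0 \<Longrightarrow> (M *v z)$i = 0" "z \<noteq> 0"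
    using assms by (auto simp: nondegenerate_support_def)
  show ?thesis
  proof (cases "\<exists>i. z$i < 0")
    case True
    then show ?thesis using z that by blast
  next
    case False
    moreover obtain i where "z$i \<noteq> 0" using z(3) by (auto simp: vec_eq_iff)
    ultimately have "(- z)$i < 0" by (metis linorder_neqE_linordered_idom neg_less_0_iff_less vector_uminus_component)
    then show ?thesis using z that[of "- z"] by (auto simp: vec.neg)
  qed
qed

text \<open>A solution of smallest support qualifies. A degenerate direction \<open>z\<close> has
  z_i (Mz)_i = 0 for all i, so column adequacy yields Mz = 0; moving along \<open>z\<close> keeps
  the residual and, by the ratio rule, loses a support index.\<close>

lemma column_adequate_lcp_basic_solution:
  fixes M :: "real^'n^'n"
  assumes M: "column_adequate M" and ex: "lcp_solution M q x0"
  obtains x where "lcp_solution M q x" "nondegenerate_support M x"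
proof -
  obtain x where x: "lcp_solution M q x"
    and min: "\<And>y. lcp_solution M q y \<Longrightarrow> card {i. x$i \<noteq> 0} \<le> card {i. y$i \<noteq> 0}"
    using ex_has_least_nat[of "lcp_solution M q" x0 "\<lambda>x. card {i. x$i \<noteq> 0}"] ex by auto
  have "nondegenerate_support M x"
  proof (rule ccontr)
    assume "\<not> nondegenerate_support M x"
    then obtain z where z: "\<And>i. x$i = 0 \<Longrightarrow> z$i = 0" "\<And>i. x$i \<noteq> 0 \<Longrightarrow> (M *v z)$i = 0" "\<exists>i. z$i < 0"
      using not_nondegenerate_support by blast
    have "z$i * (M *v z)$i = 0" for i using z(1,2)[of i] by auto
    then have "\<forall>i. z$i * (M *v z)$i \<le> 0" by (metis order_refl)
    then have Mz: "M *v z = 0" using M by (auto simp: column_adequate_def)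
    have x0: "\<And>i. 0 \<le> x$i" using x by (simp add: lcp_solution_def)
    obtain t i where t: "t > 0" "\<And>i. 0 \<le> x$i + t * z$i" "x$i + t * z$i = 0" "x$i > 0"
      using ratio_test[OF x0 z(1,3)] by blast
    have "M *v (x + t *\<^sub>R z) + q = M *v x + q"
      by (simp add: matrix_vector_right_distrib matrix_vector_mult_scaleR Mz)
    then have "lcp_solution M q (x + t *\<^sub>R z)"
      using x t(2) z(1) unfolding lcp_solution_def
      by (metis add.right_neutral mult_eq_0_iff vector_add_component vector_scaleR_component
          scaleR_conv_of_real of_real_eq_id id_apply)
    then have "card {i. x$i \<noteq> 0} \<le> card {i. (x + t *\<^sub>R z)$i \<noteq> 0}" by (rule min)
    moreover have "{i. (x + t *\<^sub>R z)$i \<noteq> 0} \<subset> {i. x$i \<noteq> 0}"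
      using z(1) t by auto
    then have "card {i. (x + t *\<^sub>R z)$i \<noteq> 0} < card {i. x$i \<noteq> 0}"
      by (intro psubset_card_mono) auto
    ultimately show False by simp
  qed
  with x show ?thesis using that by blast
qed

section \<open>Existence for adequate matrices\<close>

lemma tendsto_vec_nth_nonneg:
  fixes x :: "nat \<Rightarrow> real^'n"
  assumes "x \<longlonglongrightarrow> l" "\<And>n. 0 \<le> x n $ i" shows "0 \<le> l $ i"
  using tendsto_lowerbound[OF tendsto_vec_nth[OF assms(1), of i], of 0] assms(2) by simp

lemma tendsto_matrix_vector_mult:
  fixes M :: "real^'n^'m"
  assumes "(f \<longlongrightarrow> l) F" shows "((\<lambda>x. M *v f x) \<longlongrightarrow> M *v l) F"
  using bounded_linear.tendsto[OF matrix_vector_mul_bounded_linear assms] .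

lemma inner_matrix_vector_transpose:
  fixes M :: "real^'n^'m"
  shows "inner z (M *v x) = inner (transpose M *v z) x"
  by (simp add: dot_lmul_matrix transpose_matrix_vector)

text \<open>A theorem of the alternative on the support of \<open>y\<close>. Unless the simplex
  \<open>\<Delta>\<close> contains a vector whose image under M^T vanishes on that support,
  separation yields \<open>u\<close> with Mu > 0 there; subtracting a large multiple of the kernel
  vector \<open>y\<close> makes \<open>u\<close> nonpositive there without changing Mu, against
  column adequacy. Row adequacy then extends the vanishing of M^T z to all coordinates.\<close>

lemma adequate_nonneg_left_kernel:
  fixes M :: "real^'n^'n"
  assumes M: "adequate M" and y: "\<And>i. 0 \<le> y$i" "y \<noteq> 0" "M *v y = 0"
  obtains z where "z \<noteq> 0" "\<And>i. 0 \<le> z$i" "\<And>i. y$i = 0 \<Longrightarrow> z$i = 0" "transpose M *v z = 0"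
proof -
  define pr :: "real^'n \<Rightarrow> real^'n" where "pr v = (\<chi> i. if y$i = 0 then 0 else v$i)" for v
  define \<Delta> where "\<Delta> = convex hull ((\<lambda>i. axis i (1::real)) ` {i. y$i \<noteq> 0})"
  have pr: "linear pr"
    by (auto simp: pr_def vec_eq_iff intro!: linearI)
  define L where "L = pr \<circ> (\<lambda>z. transpose M *v z)"
  have L: "linear L" unfolding L_def by (intro linear_compose[OF _ pr]) simp
  have "\<Delta> \<subseteq> {z. (\<forall>i. 0 \<le> z$i) \<and> (\<forall>i. y$i = 0 \<longrightarrow> z$i = 0) \<and> (\<Sum>i\<in>UNIV. z$i) = 1}"
    unfolding \<Delta>_def
  proof (rule hull_minimal)
    show "convex {z :: real^'n. (\<forall>i. 0 \<le> z$i) \<and> (\<forall>i. y$i = 0 \<longrightarrow> z$i = 0) \<and> (\<Sum>i\<in>UNIV. z$i) = 1}"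
      by (auto simp: convex_def sum.distrib sum_distrib_left[symmetric])
  qed (auto simp: axis_def)
  then have \<Delta>: "\<And>i. 0 \<le> z$i" "\<And>i. y$i = 0 \<Longrightarrow> z$i = 0" "z \<noteq> 0" if "z \<in> \<Delta>" for z
    using that by auto
  have "0 \<in> L ` \<Delta>"
  proof (rule ccontr)
    assume "0 \<notin> L ` \<Delta>"
    moreover have "compact (L ` \<Delta>)" unfolding \<Delta>_def
      by (intro compact_continuous_image finite_imp_compact_convex_hull linear_continuous_on)
        (auto simp: L linear_linear)
    moreover have "convex (L ` \<Delta>)" unfolding \<Delta>_def by (intro convex_linear_image L) simp
    ultimately obtain a b where a: "b > 0" "\<And>v. v \<in> L ` \<Delta> \<Longrightarrow> inner a v > b"
      using separating_hyperplane_closed_0[of "L ` \<Delta>"] compact_imp_closed by metis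
    define u where "u = pr a"
    have pos: "(M *v u)$i > 0" if "y$i \<noteq> 0" for i
    proof -
      have "axis i 1 \<in> \<Delta>" unfolding \<Delta>_def using that by (auto intro!: hull_inc)
      then have "inner a (L (axis i 1)) > 0" using a by force
      moreover have "inner a (pr v) = inner u v" for v
        by (auto simp: u_def pr_def inner_vec_def intro!: sum.cong)
      ultimately have "inner u (transpose M *v axis i 1) > 0" by (simp add: L_def)
      then have "inner (M *v u) (axis i 1) > 0"
        by (simp only: inner_matrix_vector_transpose transpose_transpose)
      then show ?thesis by (simp add: inner_axis)
    qed
    \<comment> \<open>Chosen so that s y_i \<ge> |u_i| on the support; the summand of index i alone
      already achieves this at i.\<close>
    define s where "s = (\<Sum>i\<in>UNIV. \<bar>u$i\<bar> / y$i)"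
    define z where "z = u - s *\<^sub>R y"
    have Mz: "M *v z = M *v u"
      by (simp add: z_def matrix_vector_mult_diff_distrib matrix_vector_mult_scaleR y)
    have "z$i * (M *v z)$i \<le> 0" for i
    proof (cases "y$i = 0")
      case True
      then show ?thesis by (simp add: z_def u_def pr_def)
    next
      case False
      then have yi: "y$i > 0" using y(1)[of i] by simp
      have "\<bar>u$i\<bar> / y$i \<le> s" unfolding s_def using y(1)
        by (intro member_le_sum) auto
      then have "\<bar>u$i\<bar> \<le> s * y$i" using yi by (simp add: pos_divide_le_eq)
      then have "z$i \<le> 0" by (simp add: z_def)
      then show ?thesis using pos[OF False] by (simp add: Mz mult_nonpos_nonneg)
    qed
    then have "M *v z = 0" using M by (auto simp: adequate_def column_adequate_def)
    moreover obtain i where "y$i \<noteq> 0" using y(2) by (auto simp: vec_eq_iff)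
    ultimately show False using pos[of i] by (simp add: Mz)
  qed
  then obtain z where z: "z \<in> \<Delta>" "L z = 0" by auto
  have "z$i * (transpose M *v z)$i \<le> 0" for i
  proof (cases "y$i = 0")
    case False
    then have "(transpose M *v z)$i = L z $ i" by (simp add: L_def pr_def)
    then show ?thesis using z by simp
  qed (use \<Delta> z in auto)
  then have "transpose M *v z = 0"
    using M by (auto simp: adequate_def row_adequate_def column_adequate_def)
  then show ?thesis using that \<Delta>[OF z(1)] by blast
qed

text \<open>A fixed point of the projection of x - (Mx + q) onto the box, that is, a solution of the
  variational inequality there. Only at the upper face can the residual be negative.\<close>

lemma box_lcp_solution:
  fixes M :: "real^'n^'n"
  assumes "R \<ge> 0"
  obtains x where "\<And>i. 0 \<le> x$i" "\<And>i. x$i \<le> R"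
    "\<And>i. 0 < x$i \<Longrightarrow> (M *v x + q)$i \<le> 0" "\<And>i. x$i < R \<Longrightarrow> 0 \<le> (M *v x + q)$i"
proof -
  define G :: "real^'n \<Rightarrow> real^'n" where "G x = (\<chi> i. max 0 (min R (x$i - (M *v x + q)$i)))" for x
  have "continuous_on (cbox 0 (\<chi> i. R)) G" unfolding G_def
    by (intro continuous_on_vec_lambda continuous_intros
          linear_continuous_on[OF matrix_vector_mul_bounded_linear])
  moreover have "G \<in> cbox 0 (\<chi> i. R) \<rightarrow> cbox 0 (\<chi> i. R)"
    using assms by (auto simp: G_def mem_box_cart)
  moreover have "cbox 0 (\<chi> i. R) \<noteq> ({} :: (real^'n) set)"
    using assms by (auto simp: interval_ne_empty_cart)
  ultimately obtain x where x: "x \<in> cbox 0 (\<chi> i. R)" "G x = x"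
    using brouwer[OF compact_cbox convex_box(1)] by metis
  have *: "max 0 (min R (x$i - (M *v x + q)$i)) = x$i" for i
    using x(2) unfolding G_def by (metis vec_lambda_beta)
  show ?thesis
  proof
    fix i
    show "0 \<le> x$i" "x$i \<le> R" using x(1) by (auto simp: mem_box_cart)
    show "(M *v x + q)$i \<le> 0" if "0 < x$i" using *[of i] that by linarith
    show "0 \<le> (M *v x + q)$i" if "x$i < R" using *[of i] that \<open>0 \<le> x$i\<close> by linarith
  qed
qed

text \<open>
  The problem truncated to \<open>[0, R]^n\<close> is solvable by Brouwer's theorem. If truncation were active for
  every \<open>R\<close>, the rescaled solutions \<open>x / R\<close> would accumulate at some \<open>l \<ge> 0\<close>, \<open>l \<noteq> 0\<close> with \<open>M l = 0\<close>. A
  nonnegative left kernel vector \<open>z\<close> supported in the support of \<open>l\<close> then satisfies \<open>z \<bullet> q > 0\<close> by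
  strict feasibility, but \<open>z \<bullet> q \<le> 0\<close> because the residual is nonpositive on the support of \<open>l\<close>.
\<close>

lemma adequate_strictly_feasible_lcp:
  fixes M :: "real^'n^'n"
  assumes M: "adequate M" and v: "\<And>i. 0 < (M *v v + q)$i"
  shows "\<exists>x. lcp_solution M q x"
proof (rule ccontr)
  assume nosol: "\<not> ?thesis"
  have "\<exists>x. (\<forall>i. 0 \<le> x$i \<and> x$i \<le> R \<and> (0 < x$i \<longrightarrow> (M *v x + q)$i \<le> 0)) \<and> (\<exists>i. x$i = R)"
    if R: "R \<ge> 0" for R
  proof -
    obtain x where x: "\<And>i. 0 \<le> x$i" "\<And>i. x$i \<le> R"
      "\<And>i. 0 < x$i \<Longrightarrow> (M *v x + q)$i \<le> 0" "\<And>i. x$i < R \<Longrightarrow> 0 \<le> (M *v x + q)$i"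
      using box_lcp_solution[OF R] by metis
    have "\<exists>i. x$i = R"
    proof (rule ccontr)
      assume "\<not> (\<exists>i. x$i = R)"
      then have lt: "x$i < R" for i using x(2)[of i] by (metis order_le_less)
      have "x$i * (M *v x + q)$i = 0" for i
        using x(1)[of i] x(3)[of i] x(4)[OF lt, of i] by (cases "x$i = 0") auto
      then have "lcp_solution M q x" using x(1) x(4)[OF lt] by (simp add: lcp_solution_def)
      then show False using nosol by blast
    qed
    then show ?thesis using x by blast
  qed
  then have "\<exists>x. (\<forall>i. 0 \<le> x$i \<and> x$i \<le> real (Suc n) \<and> (0 < x$i \<longrightarrow> (M *v x + q)$i \<le> 0)) \<and>
      (\<exists>i. x$i = real (Suc n))" for n
    by (metis of_nat_0_le_iff)
  then obtain x where x: "\<And>n i. 0 \<le> x n$i" "\<And>n i. x n$i \<le> real (Suc n)"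
      "\<And>n i. 0 < x n$i \<Longrightarrow> (M *v x n + q)$i \<le> 0" "\<And>n. \<exists>i. x n$i = real (Suc n)"
    by metis
  define y where "y n = (1 / real (Suc n)) *\<^sub>R x n" for n
  have y01: "y n \<in> cbox 0 (\<chi> i. 1)" for n
    using x(1,2)[of n] by (simp add: y_def mem_box_cart)
  obtain l r where r: "strict_mono r" "(y \<circ> r) \<longlonglongrightarrow> l"
    using compact_cbox[of 0 "(\<chi> i. 1) :: real^'n"] y01 unfolding compact_def by metis
  have l0: "0 \<le> l$i" for i
    using tendsto_vec_nth_nonneg[OF r(2), of i] x(1) by (simp add: y_def)
  \<comment> \<open>The coordinate that equals 1 may change with \<open>n\<close>; the coordinate
    sum keeps the limit away from 0 regardless.\<close>
  have "1 \<le> (\<Sum>i\<in>UNIV. y n$i)" for n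
  proof -
    obtain i where "x n$i = real (Suc n)" using x(4) by blast
    then have "1 = y n$i" by (simp add: y_def)
    also have "\<dots> \<le> (\<Sum>i\<in>UNIV. y n$i)" using x(1) by (intro member_le_sum) (auto simp: y_def)
    finally show ?thesis .
  qed
  then have "1 \<le> (\<Sum>i\<in>UNIV. l$i)"
    using r(2)[unfolded comp_def]
    by (intro tendsto_lowerbound[of "\<lambda>n. \<Sum>i\<in>UNIV. y (r n)$i" _ sequentially])
      (auto intro!: tendsto_intros)
  then have "l \<noteq> 0" by auto
  have ev: "\<forall>\<^sub>F n in sequentially. (M *v x (r n) + q)$i \<le> 0" if "l$i \<noteq> 0" for i
  proof -
    have "l$i > 0" using l0[of i] that by simp
    then have "\<forall>\<^sub>F n in sequentially. (y \<circ> r) n $ i > 0"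
      using order_tendstoD(1)[OF tendsto_vec_nth[OF r(2), of i]] by blast
    then show ?thesis
      by eventually_elim (use x(3) in \<open>auto simp: y_def zero_less_divide_iff\<close>)
  qed
  have lim: "(\<lambda>n. M *v (y \<circ> r) n + (1 / real (Suc (r n))) *\<^sub>R q) \<longlonglongrightarrow> M *v l + 0 *\<^sub>R q"
    using LIMSEQ_subseq_LIMSEQ[OF LIMSEQ_Suc[OF lim_1_over_n] r(1)]
    by (intro tendsto_intros tendsto_matrix_vector_mult r) (auto simp: o_def)
  have "l$i * (M *v l)$i \<le> 0" for i
  proof (cases "l$i = 0")
    case False
    have "(M *v l + 0 *\<^sub>R q)$i \<le> 0"
    proof (rule tendsto_upperbound[OF tendsto_vec_nth[OF lim]])
      show "\<forall>\<^sub>F n in sequentially. (M *v (y \<circ> r) n + (1 / real (Suc (r n))) *\<^sub>R q)$i \<le> 0"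
        using ev[OF False]
      proof eventually_elim
        case (elim n)
        have "(M *v (y \<circ> r) n + (1 / real (Suc (r n))) *\<^sub>R q)$i
            = (1 / real (Suc (r n))) * (M *v x (r n) + q)$i"
          by (simp add: y_def matrix_vector_mult_scaleR algebra_simps add_divide_distrib)
        then show ?case using elim by (simp add: divide_nonpos_pos)
      qed
    qed simp
    then show ?thesis using l0[of i] by (simp add: mult_nonneg_nonpos)
  qed simp
  then have "M *v l = 0" using M by (auto simp: adequate_def column_adequate_def)
  then obtain z where z: "z \<noteq> 0" "\<And>i. 0 \<le> z$i" "\<And>i. l$i = 0 \<Longrightarrow> z$i = 0" "transpose M *v z = 0"
    using adequate_nonneg_left_kernel[OF M l0 \<open>l \<noteq> 0\<close>] by metis
  \<comment> \<open>A left kernel vector does not see the point \<open>u\<close>, which lets the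
    strictly feasible \<open>v\<close> be compared with the truncated solutions.\<close>
  have zq: "inner z (M *v u + q) = inner z q" for u
    by (simp only: inner_add_right inner_matrix_vector_transpose z(4) inner_zero_left add_0)
  obtain i where "z$i \<noteq> 0" using z(1) by (auto simp: vec_eq_iff)
  then have "0 < z$i * (M *v v + q)$i" using z(2)[of i] v[of i] by simp
  also have "\<dots> \<le> inner z (M *v v + q)"
    unfolding inner_vec_def inner_real_def using z(2) v
    by (intro member_le_sum)
      (auto intro!: mult_nonneg_nonneg less_imp_le[OF v] simp del: vector_add_component)
  finally have "0 < inner z q" by (simp add: zq)
  have "\<forall>\<^sub>F n in sequentially. \<forall>i\<in>{i. l$i \<noteq> 0}. (M *v x (r n) + q)$i \<le> 0"
    using ev by (intro eventually_ball_finite) auto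
  then obtain n where n: "\<And>i. l$i \<noteq> 0 \<Longrightarrow> (M *v x (r n) + q)$i \<le> 0"
    using eventually_happens'[OF sequentially_bot] by fastforce
  have "z$i * (M *v x (r n) + q)$i \<le> 0" for i
    using z(2,3)[of i] n[of i] by (cases "l$i = 0") (auto intro: mult_nonneg_nonpos simp del: vector_add_component)
  then have "inner z (M *v x (r n) + q) \<le> 0"
    unfolding inner_vec_def inner_real_def by (intro sum_nonpos) auto
  with \<open>0 < inner z q\<close> show False by (simp add: zq)
qed

text \<open>
  Adding a small positive vector to \<open>q\<close> makes the problem strictly feasible; the bound on the
  solutions is uniform in the perturbation, so they accumulate at a solution for \<open>q\<close>.
\<close>

lemma adequate_lcp_bounded_solution:
  fixes M :: "real^'n^'n"
  assumes M: "adequate M" and v: "\<And>i. 0 \<le> (M *v v + q)$i"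
  obtains x where "lcp_solution M q x" "vec_norm1 x \<le> beta_const M * vec_norm1 q"
proof -
  define q' where "q' n = q + (1 / real (Suc n)) *\<^sub>R 1" for n
  have "\<exists>x. lcp_solution M (q' n) x \<and> vec_norm1 x \<le> beta_const M * vec_norm1 (q' n)" for n
  proof -
    have "0 < (M *v v + q' n)$i" for i
      using v[of i] by (simp add: q'_def add_pos_nonneg add.assoc[symmetric] add_nonneg_pos)
    then obtain x where "lcp_solution M (q' n) x" using adequate_strictly_feasible_lcp[OF M] by metis
    then show ?thesis
      using column_adequate_lcp_basic_solution lcp_solution_norm_le M unfolding adequate_def by metis
  qed
  then obtain x where x: "\<And>n. lcp_solution M (q' n) (x n)"
      "\<And>n. vec_norm1 (x n) \<le> beta_const M * vec_norm1 (q' n)" by metis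
  have q': "q' \<longlonglongrightarrow> q + 0 *\<^sub>R 1" unfolding q'_def
    by (intro tendsto_intros LIMSEQ_Suc[OF lim_1_over_n])
  have "bounded (range q')" using q' by (rule convergent_imp_bounded)
  then obtain b where b: "\<And>n. norm (q' n) \<le> b" by (auto simp: bounded_iff)
  have "norm (x n) \<le> beta_const M * (\<Sum>i\<in>(UNIV::'n set). b)" for n
  proof -
    have "vec_norm1 (q' n) \<le> (\<Sum>i\<in>(UNIV::'n set). b)" unfolding vec_norm1_def
      using b component_le_norm_cart order_trans by (intro sum_mono) blast
    then show ?thesis
      using norm_le_vec_norm1[of "x n"] x(2)[of n] mult_left_mono[OF _ beta_const_nonneg]
      by (meson order_trans)
  qed
  then obtain l r where r: "strict_mono r" "(x \<circ> r) \<longlonglongrightarrow> l"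
    using compact_cball[of 0] unfolding compact_def by (metis mem_cball_0)
  have q'r: "(q' \<circ> r) \<longlonglongrightarrow> q" using LIMSEQ_subseq_LIMSEQ[OF q' r(1)] by simp
  have w: "(\<lambda>n. M *v (x \<circ> r) n + (q' \<circ> r) n) \<longlonglongrightarrow> M *v l + q"
    by (intro tendsto_intros tendsto_matrix_vector_mult r q'r)
  have "0 \<le> l$i" for i
    using tendsto_vec_nth_nonneg[OF r(2)] x(1) by (simp add: lcp_solution_def)
  moreover have "0 \<le> (M *v l + q)$i" for i
    using tendsto_vec_nth_nonneg[OF w] x(1) by (simp add: lcp_solution_def)
  moreover have "l$i * (M *v l + q)$i = 0" for i
  proof (rule LIMSEQ_unique)
    show "(\<lambda>n. (x \<circ> r) n$i * (M *v (x \<circ> r) n + (q' \<circ> r) n)$i) \<longlonglongrightarrow> l$i * (M *v l + q)$i"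
      by (intro tendsto_mult tendsto_vec_nth r w)
    show "(\<lambda>n. (x \<circ> r) n$i * (M *v (x \<circ> r) n + (q' \<circ> r) n)$i) \<longlonglongrightarrow> 0"
    proof -
      have "x n$i * (M *v x n + q' n)$i = 0" for n using x(1) unfolding lcp_solution_def by blast
      then show ?thesis by (simp only: comp_def tendsto_const)
    qed
  qed
  ultimately have "lcp_solution M q l" by (simp add: lcp_solution_def)
  moreover have "vec_norm1 l \<le> beta_const M * vec_norm1 q"
    by (rule LIMSEQ_le[OF tendsto_vec_norm1[OF r(2)] tendsto_mult_left[OF tendsto_vec_norm1[OF q'r]]])
      (use x(2) in auto)
  ultimately show ?thesis using that by blast
qed

section \<open>Existence for Z-matrices\<close>

text \<open>Row \<open>i\<close> of M(y - u) pairs nonpositive off-diagonal entries with nonpositive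
  differences. Lowering the other coordinates thus never destroys the inequality of row
  \<open>i\<close>.\<close>

lemma Z_matrix_mult_mono:
  fixes M :: "real^'n^'n"
  assumes Z: "Z_matrix M" and y: "\<And>j. y$j \<le> u$j" "y$i = u$i"
  shows "(M *v u)$i \<le> (M *v y)$i"
  unfolding matrix_vector_mult_def
proof (simp, intro sum_mono)
  fix j show "M$i$j * u$j \<le> M$i$j * y$j"
    using Z y by (cases "j = i") (auto simp: Z_matrix_def intro!: mult_left_mono_neg)
qed

text \<open>The solution is the least element of the feasible set, which is closed under meets.\<close>

lemma Z_matrix_lcp_basic_solution:
  fixes M :: "real^'n^'n"
  assumes Z: "Z_matrix M" and v: "\<And>i. 0 \<le> v$i" "\<And>i. 0 \<le> (M *v v + q)$i"
  obtains x where "lcp_solution M q x" "nondegenerate_support M x"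
proof -
  define V where "V = {x. \<forall>i. 0 \<le> x$i \<and> 0 \<le> (M *v x + q)$i}"
  \<comment> \<open>On \<open>V\<close> the coordinate sum dominates the norm, so a point of
    \<open>V\<close> outside this ball has a larger sum than \<open>v\<close>; minimising over the
    compact \<open>W\<close> is minimising over \<open>V\<close>.\<close>
  define W where "W = V \<inter> cball 0 (\<Sum>i\<in>UNIV. v$i)"
  define s where "s x = (\<Sum>i\<in>UNIV. x$i)" for x :: "real^'n"
  have le: "norm x \<le> s x" if "x \<in> V" for x
    using that norm_le_l1_cart[of x] by (simp add: V_def s_def)
  have cM: "continuous_on UNIV ((*v) M)"
    by (intro linear_continuous_on matrix_vector_mul_bounded_linear)
  have "closed V" unfolding V_def
    by (intro closed_Collect_all closed_Collect_conj closed_Collect_le continuous_intros cM)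
  then have "compact W" unfolding W_def by (intro closed_Int_compact) auto
  moreover have "v \<in> V" using v by (simp add: V_def)
  then have vW: "v \<in> W" using le[of v] by (simp add: W_def s_def)
  moreover have "continuous_on W s" unfolding s_def by (intro continuous_intros)
  ultimately obtain x where x: "x \<in> W" "\<And>y. y \<in> W \<Longrightarrow> s x \<le> s y"
    using continuous_attains_inf[of W s] by blast
  have min: "s x \<le> s y" if "y \<in> V" for y
  proof (cases "y \<in> W")
    case False
    then have "s v < s y" using le[OF that] that by (auto simp: W_def s_def not_le)
    then show ?thesis using x(2)[OF vW] by simp
  qed (simp add: x)
  have xV: "\<And>i. 0 \<le> x$i" "\<And>i. 0 \<le> (M *v x + q)$i" using x(1) by (auto simp: W_def V_def)
  have least: "y = x" if y: "y \<in> V" "\<And>i. y$i \<le> x$i" for y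
  proof -
    have "(\<Sum>i\<in>UNIV. x$i - y$i) = 0"
      using min[OF y(1)] sum_mono[of UNIV "($) y" "($) x"] y(2) unfolding s_def sum_subtractf by force
    then have "\<forall>i\<in>UNIV. x$i - y$i = 0" using y(2) by (subst (asm) sum_nonneg_eq_0_iff) auto
    then show ?thesis by (simp add: vec_eq_iff)
  qed
  have "x$i * (M *v x + q)$i = 0" for i
  proof (rule ccontr)
    assume "x$i * (M *v x + q)$i \<noteq> 0"
    then have pos: "x$i > 0" "(M *v x + q)$i > 0"
      using xV[of i] by (auto simp: less_le simp del: vector_add_component)
    \<comment> \<open>Lowering x_i by \<open>t\<close> keeps it nonnegative and uses at most the
      slack of row \<open>i\<close>; the summand 1 excludes division by zero.\<close>
    define t where "t = min (x$i) ((M *v x + q)$i / (\<bar>M$i$i\<bar> + 1))"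
    have t: "t > 0" "t \<le> x$i" "t * (\<bar>M$i$i\<bar> + 1) \<le> (M *v x + q)$i"
    proof -
      show "t > 0" "t \<le> x$i" using pos by (auto simp: t_def simp del: vector_add_component)
      have "t \<le> (M *v x + q)$i / (\<bar>M$i$i\<bar> + 1)" by (simp add: t_def)
      then show "t * (\<bar>M$i$i\<bar> + 1) \<le> (M *v x + q)$i" by (subst (asm) pos_le_divide_eq) auto
    qed
    define y where "y = x - t *\<^sub>R axis i 1"
    have yx: "y$j = x$j - (if j = i then t else 0)" for j
      by (simp add: y_def axis_def)
    have "y \<in> V" unfolding V_def
    proof (intro CollectI allI conjI)
      fix j
      show "0 \<le> y$j" using xV(1)[of j] t by (simp add: yx)
      show "0 \<le> (M *v y + q)$j"
      proof (cases "j = i")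
        case True
        have "(M *v y)$i = (M *v x)$i - t * M$i$i"
          by (simp add: y_def matrix_vector_mult_diff_distrib matrix_vector_mult_scaleR
              matrix_vector_mult_basis column_def)
        moreover have "t * M$i$i \<le> t * (\<bar>M$i$i\<bar> + 1)" using t by (intro mult_left_mono) auto
        ultimately show ?thesis using t(3) unfolding True vector_add_component by linarith
      next
        case False
        have "(M *v x)$j \<le> (M *v y)$j"
          using t False by (intro Z_matrix_mult_mono Z) (auto simp: yx)
        then show ?thesis using xV(2)[of j] by simp
      qed
    qed
    then have "y = x" using t by (intro least) (auto simp: yx)
    then show False using t yx[of i] by simp
  qed
  then have sol: "lcp_solution M q x" using xV by (simp add: lcp_solution_def)
  have "nondegenerate_support M x"
  proof (rule ccontr)
    assume "\<not> nondegenerate_support M x"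
    then obtain z where z: "\<And>i. x$i = 0 \<Longrightarrow> z$i = 0" "\<And>i. x$i \<noteq> 0 \<Longrightarrow> (M *v z)$i = 0" "\<exists>i. z$i < 0"
      using not_nondegenerate_support by blast
    obtain t i where t: "t > 0" "\<And>i. 0 \<le> x$i + t * z$i" "x$i + t * z$i = 0" "x$i > 0"
      using ratio_test[OF xV(1) z(1,3)] by blast
    \<comment> \<open>The shifted point may violate rows off the support, but its meet with
      \<open>x\<close> does not: rows where the meet agrees with \<open>x\<close> are compared with
      \<open>x\<close>, and all others belong to support indices, where Mz = 0.\<close>
    define y where "y = vec_min x (x + t *\<^sub>R z)"
    have ym: "y$j = min (x$j) (x$j + t * z$j)" for j by (simp add: y_def vec_min_def)
    have "y \<in> V" unfolding V_def
    proof (intro CollectI allI conjI)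
      fix j
      show "0 \<le> y$j" using xV(1)[of j] t by (simp add: ym)
      show "0 \<le> (M *v y + q)$j"
      proof (cases "y$j = x$j")
        case True
        then have "(M *v x)$j \<le> (M *v y)$j"
          by (intro Z_matrix_mult_mono Z) (auto simp: ym)
        then show ?thesis using xV(2)[of j] by simp
      next
        case False
        then have xj: "x$j \<noteq> 0" using z(1)[of j] by (auto simp: ym)
        have "(M *v (x + t *\<^sub>R z))$j \<le> (M *v y)$j"
          using False by (intro Z_matrix_mult_mono Z) (auto simp: ym)
        moreover have "(M *v (x + t *\<^sub>R z))$j = (M *v x)$j"
          using z(2)[OF xj] by (simp add: matrix_vector_right_distrib matrix_vector_mult_scaleR)
        ultimately show ?thesis using xV(2)[of j] by simp
      qed
    qed
    then have "y = x" by (intro least) (auto simp: ym)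
    then show False using t ym[of i] by simp
  qed
  with sol show ?thesis using that by blast
qed

theorem lcp_bounded_solution:
  fixes M :: "real^'n^'n"
  assumes "adequate M \<or> Z_matrix M" and "\<And>i. 0 \<le> v$i" "\<And>i. 0 \<le> (M *v v + q)$i"
  obtains x where "lcp_solution M q x" "vec_norm1 x \<le> beta_const M * vec_norm1 q"
  using assms adequate_lcp_bounded_solution[of M v q] Z_matrix_lcp_basic_solution[of M v q]
    lcp_solution_norm_le by metis

section \<open>The strong law of large numbers\<close>

text \<open>With \<open>m\<close> the first exponent such that x \<le> \<alpha>^m, the terms
  \<alpha>^n below \<open>m\<close> and x^2/\<alpha>^n from \<open>m\<close> on form geometric
  series governed by their term nearest to \<open>m\<close>. Each costs \<alpha>/(\<alpha>-1) times
  x, whence the factor 2.\<close>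

lemma geometric_truncation_sum:
  fixes \<alpha> x :: real
  assumes \<alpha>: "\<alpha> > 1" and x: "x \<ge> 0"
  shows "(\<Sum>n<N. min (x\<^sup>2 / \<alpha>^n) (\<alpha>^n)) \<le> 2 * \<alpha> / (\<alpha> - 1) * x"
proof -
  define m where "m = (LEAST n. x \<le> \<alpha>^n)"
  have "\<exists>n. x \<le> \<alpha>^n" using real_arch_pow[OF \<alpha>, of x] by (auto intro: less_imp_le)
  then have m: "x \<le> \<alpha>^m" unfolding m_def by (rule LeastI_ex)
  have "(\<Sum>n<m. \<alpha>^n) \<le> \<alpha> / (\<alpha> - 1) * x"
  proof (cases m)
    case (Suc l)
    have "\<alpha>^l \<le> x" using not_less_Least[of l "\<lambda>n. x \<le> \<alpha>^n"] Suc unfolding m_def[symmetric] by auto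
    have "(\<Sum>n<m. \<alpha>^n) = (\<alpha>^m - 1) / (\<alpha> - 1)" using \<alpha> by (simp add: geometric_sum)
    also have "\<dots> \<le> (\<alpha> * \<alpha>^l) / (\<alpha> - 1)" using \<alpha> by (intro divide_right_mono) (auto simp: Suc)
    also have "\<dots> \<le> (\<alpha> * x) / (\<alpha> - 1)" using \<alpha> \<open>\<alpha>^l \<le> x\<close> by (intro divide_right_mono mult_left_mono) auto
    finally show ?thesis by simp
  qed (use \<alpha> x in auto)
  moreover have "(\<Sum>n=m..<N. x\<^sup>2 / \<alpha>^n) \<le> \<alpha> / (\<alpha> - 1) * x"
  proof -
    have tail: "(\<Sum>n=m..<m+p. 1 / \<alpha>^n) \<le> \<alpha> / (\<alpha> - 1) * (1 / \<alpha>^m)" for p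
    proof -
      have "(\<Sum>n=m..<m+p. 1 / \<alpha>^n) = \<alpha> / (\<alpha> - 1) * (1 / \<alpha>^m - 1 / \<alpha>^(m+p))"
      proof (induction p)
        case (Suc p)
        have "\<alpha> / (\<alpha> - 1) * (c - b) + b = \<alpha> / (\<alpha> - 1) * (c - b / \<alpha>)" for b c :: real
          using \<alpha> by (simp add: field_simps)
        from this[of "1 / \<alpha>^m" "1 / \<alpha>^(m+p)"] Suc show ?case by (simp add: mult.commute)
      qed simp
      also have "\<dots> \<le> \<alpha> / (\<alpha> - 1) * (1 / \<alpha>^m)" using \<alpha> by (intro mult_left_mono) auto
      finally show ?thesis .
    qed
    have "(\<Sum>n=m..<N. x\<^sup>2 / \<alpha>^n) = x\<^sup>2 * (\<Sum>n=m..<N. 1 / \<alpha>^n)" by (simp add: sum_distrib_left)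
    \<comment> \<open>\<open>tail[of 0]\<close> serves the case N < m, where the range of summation
      is empty.\<close>
    also have "\<dots> \<le> x\<^sup>2 * (\<alpha> / (\<alpha> - 1) * (1 / \<alpha>^m))"
      using tail[of "N - m"] tail[of 0] by (intro mult_left_mono) (cases "m \<le> N", auto)
    also have "\<dots> = \<alpha> / (\<alpha> - 1) * (x * (x / \<alpha>^m))" by (simp add: power2_eq_square)
    also have "\<dots> \<le> \<alpha> / (\<alpha> - 1) * (x * 1)"
      using \<alpha> x m by (intro mult_left_mono) (auto simp: divide_le_eq)
    finally show ?thesis by simp
  qed
  moreover have "(\<Sum>n<N. min (x\<^sup>2 / \<alpha>^n) (\<alpha>^n)) \<le> (\<Sum>n\<in>{..<m} \<union> {m..<N}. min (x\<^sup>2 / \<alpha>^n) (\<alpha>^n))"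
    using \<alpha> x by (intro sum_mono2) auto
  moreover have "\<dots> = (\<Sum>n<m. min (x\<^sup>2 / \<alpha>^n) (\<alpha>^n)) + (\<Sum>n=m..<N. min (x\<^sup>2 / \<alpha>^n) (\<alpha>^n))"
    by (intro sum.union_disjoint) auto
  moreover have "(\<Sum>n<m. min (x\<^sup>2 / \<alpha>^n) (\<alpha>^n)) \<le> (\<Sum>n<m. \<alpha>^n)" by (intro sum_mono) auto
  moreover have "(\<Sum>n=m..<N. min (x\<^sup>2 / \<alpha>^n) (\<alpha>^n)) \<le> (\<Sum>n=m..<N. x\<^sup>2 / \<alpha>^n)" by (intro sum_mono) auto
  moreover have "2 * \<alpha> / (\<alpha> - 1) * x = \<alpha> / (\<alpha> - 1) * x + \<alpha> / (\<alpha> - 1) * x"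
    by (simp only: mult_2 add_divide_distrib distrib_right)
  ultimately show ?thesis by linarith
qed

text \<open>By Tonelli the sum of the \<open>G n\<close> has finite integral, so it is finite almost
  everywhere and its terms tend to zero. This does the work of Chebyshev together with
  Borel-Cantelli.\<close>

lemma AE_tendsto_zero_of_summable_integrals:
  fixes G :: "nat \<Rightarrow> 'a \<Rightarrow> real"
  assumes meas [measurable]: "\<And>n. G n \<in> borel_measurable M" and pos: "\<And>n x. 0 \<le> G n x"
    and fin: "(\<Sum>n. \<integral>\<^sup>+x. ennreal (G n x) \<partial>M) < \<infinity>"
  shows "AE x in M. (\<lambda>n. G n x) \<longlonglongrightarrow> 0"
proof -
  have "(\<integral>\<^sup>+x. (\<Sum>n. ennreal (G n x)) \<partial>M) \<noteq> \<infinity>"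
    using fin by (subst nn_integral_suminf) auto
  then have "AE x in M. (\<Sum>n. ennreal (G n x)) \<noteq> \<infinity>"
    by (intro nn_integral_noteq_infinite) auto
  then show ?thesis
  proof eventually_elim
    case (elim x)
    then have "summable (\<lambda>n. G n x)" using pos by (intro summable_suminf_not_top) auto
    then show ?case by (rule summable_LIMSEQ_zero)
  qed
qed

text \<open>
  Etemadi's interpolation: monotone partial sums are controlled along every sequence growing
  geometrically with a ratio close to 1.
\<close>

lemma average_tendsto_of_geometric_subsequences:
  fixes s :: "nat \<Rightarrow> real"
  assumes mono: "mono s" and pos: "\<And>n. 0 \<le> s n" and \<mu>: "\<mu> \<ge> 0"
    and sub: "\<And>m. (\<lambda>n. s (nat \<lceil>(1 + 1 / real (Suc m))^n\<rceil>) / real (nat \<lceil>(1 + 1 / real (Suc m))^n\<rceil>)) \<longlonglongrightarrow> \<mu>"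
  shows "(\<lambda>n. s n / real n) \<longlonglongrightarrow> \<mu>"
proof -
  have key: "\<exists>lo hi. lo \<longlonglongrightarrow> \<mu> / \<alpha> \<and> hi \<longlonglongrightarrow> \<mu> * \<alpha> \<and>
      (\<forall>\<^sub>F n in sequentially. lo n \<le> s n / real n \<and> s n / real n \<le> hi n)"
    if \<alpha>: "\<alpha> > 1" and lim: "(\<lambda>n. s (nat \<lceil>\<alpha>^n\<rceil>) / real (nat \<lceil>\<alpha>^n\<rceil>)) \<longlonglongrightarrow> \<mu>" for \<alpha> :: real
  proof -
    define k where "k n = nat \<lceil>\<alpha>^n\<rceil>" for n
    \<comment> \<open>For N \<ge> 1 this is the exponent with \<alpha>^(r N) \<le> N < \<alpha>^(r N
      + 1).\<close>
    define r where "r N = nat \<lfloor>log \<alpha> (real N)\<rfloor>" for N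
    have k1: "real (k n) \<ge> 1" for n
    proof -
      have "\<alpha>^n \<ge> 1" using \<alpha> by simp
      then show ?thesis unfolding k_def by linarith
    qed
    have r: "filterlim r sequentially sequentially"
      unfolding filterlim_at_top
    proof
      fix Z
      show "\<forall>\<^sub>F N in sequentially. Z \<le> r N"
        using eventually_ge_at_top[of "nat \<lceil>\<alpha>^Z\<rceil>"]
      proof eventually_elim
        case (elim N)
        have "\<alpha>^Z > 0" using \<alpha> by simp
        moreover have "\<alpha>^Z \<le> real N" using elim by linarith
        ultimately have "real N > 0" by linarith
        with \<open>\<alpha>^Z \<le> real N\<close> have "real Z \<le> log \<alpha> (real N)"
          using \<alpha> by (subst le_log_iff) (auto simp: powr_realpow)
        then show ?case unfolding r_def by (rule le_nat_floor)
      qed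
    qed
    have kb: "\<alpha>^n \<le> real (k n)" "real (k n) \<le> \<alpha>^n + 1" for n
      using \<alpha> zero_le_power[of \<alpha> n] unfolding k_def by linarith+
    have ratio: "(\<lambda>n. real (k (Suc n)) / real (k n)) \<longlonglongrightarrow> \<alpha>"
    proof (rule tendsto_sandwich)
      have inv: "(\<lambda>n. (1/\<alpha>)^n) \<longlonglongrightarrow> 0" using \<alpha> by (intro LIMSEQ_power_zero) auto
      have "(\<lambda>n. \<alpha> / (1 + (1/\<alpha>)^n)) \<longlonglongrightarrow> \<alpha> / (1 + 0)" by (intro tendsto_intros inv) auto
      then show "(\<lambda>n. \<alpha> / (1 + (1/\<alpha>)^n)) \<longlonglongrightarrow> \<alpha>" by simp
      have "(\<lambda>n. \<alpha> + (1/\<alpha>)^n) \<longlonglongrightarrow> \<alpha> + 0" by (intro tendsto_intros inv)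
      then show "(\<lambda>n. \<alpha> + (1/\<alpha>)^n) \<longlonglongrightarrow> \<alpha>" by simp
      show "\<forall>\<^sub>F n in sequentially. \<alpha> / (1 + (1/\<alpha>)^n) \<le> real (k (Suc n)) / real (k n)"
      proof (intro always_eventually allI)
        fix n
        have "\<alpha> / (1 + (1/\<alpha>)^n) = \<alpha>^Suc n / (\<alpha>^n + 1)"
          using \<alpha> by (simp add: field_simps power_divide add_pos_pos)
        also have "\<dots> \<le> real (k (Suc n)) / real (k n)"
          using kb[of n] kb[of "Suc n"] k1[of n] \<alpha> by (intro frac_le) auto
        finally show "\<alpha> / (1 + (1/\<alpha>)^n) \<le> real (k (Suc n)) / real (k n)" .
      qed
      show "\<forall>\<^sub>F n in sequentially. real (k (Suc n)) / real (k n) \<le> \<alpha> + (1/\<alpha>)^n"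
      proof (intro always_eventually allI)
        fix n
        have "real (k (Suc n)) / real (k n) \<le> (\<alpha>^Suc n + 1) / \<alpha>^n"
          using kb[of n] kb[of "Suc n"] k1[of n] \<alpha> by (intro frac_le) auto
        also have "\<dots> = \<alpha> + (1/\<alpha>)^n" using \<alpha> by (simp add: field_simps power_divide)
        finally show "real (k (Suc n)) / real (k n) \<le> \<alpha> + (1/\<alpha>)^n" .
      qed
    qed
    have limk: "(\<lambda>n. s (k n) / real (k n)) \<longlonglongrightarrow> \<mu>" using lim by (simp add: k_def)
    \<comment> \<open>After cancellation these bounds are s(k_r)/k_{r+1} and s(k_{r+1})/k_r, which
      enclose s(N)/N by monotonicity; the uncancelled form displays their limits.\<close>
    define lo where "lo N = (s (k (r N)) / real (k (r N))) / (real (k (Suc (r N))) / real (k (r N)))" for N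
    define hi where "hi N = (s (k (Suc (r N))) / real (k (Suc (r N)))) * (real (k (Suc (r N))) / real (k (r N)))" for N
    have rS: "filterlim (\<lambda>N. Suc (r N)) sequentially sequentially"
      using filterlim_compose[OF filterlim_Suc r] .
    have "lo \<longlonglongrightarrow> \<mu> / \<alpha>" unfolding lo_def using \<alpha>
      by (intro tendsto_divide filterlim_compose[OF limk r] filterlim_compose[OF ratio r]) auto
    moreover have "hi \<longlonglongrightarrow> \<mu> * \<alpha>" unfolding hi_def
      by (intro tendsto_mult filterlim_compose[OF limk rS] filterlim_compose[OF ratio r])
    moreover have "\<forall>\<^sub>F N in sequentially. lo N \<le> s N / real N \<and> s N / real N \<le> hi N"
      using eventually_ge_at_top[of 1]
    proof eventually_elim
      case (elim N)
      then have N: "real N \<ge> 1" by simp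
      have l0: "log \<alpha> (real N) \<ge> 0" using \<alpha> N by simp
      have "real (r N) \<le> log \<alpha> (real N)" "log \<alpha> (real N) < real (Suc (r N))"
        unfolding r_def using l0 by linarith+
      then have "\<alpha> powr real (r N) \<le> real N" "real N < \<alpha> powr real (Suc (r N))"
        using \<alpha> N by (simp_all add: le_log_iff log_less_iff del: of_nat_Suc)
      then have *: "\<alpha>^(r N) \<le> real N" "real N < \<alpha>^(Suc (r N))"
        using \<alpha> by (simp_all add: powr_realpow del: of_nat_Suc)
      have kN: "k (r N) \<le> N" unfolding k_def using *(1) by (simp add: nat_le_iff ceiling_le_iff)
      have Nk: "N \<le> k (Suc (r N))" using *(2) kb(1)[of "Suc (r N)"] by linarith
      have "lo N = s (k (r N)) / real (k (Suc (r N)))" unfolding lo_def using k1[of "r N"] by simp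
      also have "\<dots> \<le> s N / real N"
        using monoD[OF mono kN] Nk N pos by (intro frac_le) auto
      finally have "lo N \<le> s N / real N" .
      moreover have "hi N = s (k (Suc (r N))) / real (k (r N))"
        unfolding hi_def using k1[of "Suc (r N)"] by simp
      moreover have "s N / real N \<le> s (k (Suc (r N))) / real (k (r N))"
        using monoD[OF mono Nk] kN k1[of "r N"] pos by (intro frac_le) auto
      ultimately show ?case by simp
    qed
    ultimately show ?thesis by blast
  qed
  have inv: "(\<lambda>m. 1 + 1 / real (Suc m)) \<longlonglongrightarrow> 1 + 0"
    by (intro tendsto_intros LIMSEQ_Suc[OF lim_1_over_n])
  show ?thesis
  proof (rule order_tendstoI)
    fix a assume a: "a < \<mu>"
    have "(\<lambda>m. \<mu> / (1 + 1 / real (Suc m))) \<longlonglongrightarrow> \<mu> / (1 + 0)" by (intro tendsto_intros inv) auto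
    then have "\<forall>\<^sub>F m in sequentially. a < \<mu> / (1 + 1 / real (Suc m))"
      using a by (intro order_tendstoD) auto
    then obtain m where m: "a < \<mu> / (1 + 1 / real (Suc m))"
      using eventually_happens'[OF sequentially_bot] by blast
    obtain lo where "lo \<longlonglongrightarrow> \<mu> / (1 + 1 / real (Suc m))" "\<forall>\<^sub>F n in sequentially. lo n \<le> s n / real n"
      using key[OF _ sub[of m]] by (auto simp: eventually_conj_iff)
    then show "\<forall>\<^sub>F n in sequentially. a < s n / real n"
      using order_tendstoD(1)[OF _ m] by (fastforce elim: eventually_elim2)
  next
    fix a assume a: "\<mu> < a"
    have "(\<lambda>m. \<mu> * (1 + 1 / real (Suc m))) \<longlonglongrightarrow> \<mu> * (1 + 0)" by (intro tendsto_intros inv)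
    then have "\<forall>\<^sub>F m in sequentially. \<mu> * (1 + 1 / real (Suc m)) < a"
      using a by (intro order_tendstoD) auto
    then obtain m where m: "\<mu> * (1 + 1 / real (Suc m)) < a"
      using eventually_happens'[OF sequentially_bot] by blast
    obtain hi where "hi \<longlonglongrightarrow> \<mu> * (1 + 1 / real (Suc m))" "\<forall>\<^sub>F n in sequentially. s n / real n \<le> hi n"
      using key[OF _ sub[of m]] by (auto simp: eventually_conj_iff)
    then show "\<forall>\<^sub>F n in sequentially. s n / real n < a"
      using order_tendstoD(2)[OF _ m] by (fastforce elim: eventually_elim2)
  qed
qed

text \<open>Additivity of the variance: by independence the mixed products have product
  expectations, which vanish by centring. The uniform bound supplies all integrability.\<close>

lemma (in prob_space) square_sum_indep_centered:
  fixes W :: "'i \<Rightarrow> 'a \<Rightarrow> real"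
  assumes I: "finite I" and W: "indep_vars (\<lambda>_. borel) W I"
    and bound: "\<And>i x. i \<in> I \<Longrightarrow> \<bar>W i x\<bar> \<le> b" and mean: "\<And>i. i \<in> I \<Longrightarrow> expectation (W i) = 0"
  shows "integrable M (\<lambda>x. (\<Sum>i\<in>I. W i x)\<^sup>2)"
    and "expectation (\<lambda>x. (\<Sum>i\<in>I. W i x)\<^sup>2) = (\<Sum>i\<in>I. expectation (\<lambda>x. (W i x)\<^sup>2))"
proof -
  have meas: "W i \<in> borel_measurable M" if "i \<in> I" for i
    using W that by (auto simp: indep_vars_def2)
  have int: "integrable M (W i)" if "i \<in> I" for i
    using bound[OF that] meas[OF that] by (intro integrable_const_bound[of _ b]) auto
  have int2: "integrable M (\<lambda>x. W i x * W j x)" if "i \<in> I" "j \<in> I" for i j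
  proof (rule integrable_const_bound[of _ "b * b"])
    show "AE x in M. norm (W i x * W j x) \<le> b * b"
      using bound that by (auto simp: abs_mult intro!: mult_mono order_trans[OF abs_ge_zero])
  qed (use meas that in auto)
  have orth: "expectation (\<lambda>x. W i x * W j x) = 0" if "i \<in> I" "j \<in> I" "i \<noteq> j" for i j
  proof -
    have "indep_vars (\<lambda>_. borel) W {i, j}" by (rule indep_vars_subset[OF W]) (use that in auto)
    then have "expectation (\<lambda>x. \<Prod>l\<in>{i,j}. W l x) = (\<Prod>l\<in>{i,j}. expectation (W l))"
      using int that by (intro indep_vars_lebesgue_integral) auto
    then show ?thesis using that mean by simp
  qed
  have sq: "(\<lambda>x. (\<Sum>i\<in>I. W i x)\<^sup>2) = (\<lambda>x. \<Sum>i\<in>I. \<Sum>j\<in>I. W i x * W j x)"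
    by (simp add: power2_eq_square sum_product)
  show "integrable M (\<lambda>x. (\<Sum>i\<in>I. W i x)\<^sup>2)" unfolding sq using int2 by auto
  have "expectation (\<lambda>x. (\<Sum>i\<in>I. W i x)\<^sup>2) = (\<Sum>i\<in>I. \<Sum>j\<in>I. expectation (\<lambda>x. W i x * W j x))"
    unfolding sq using int2 by (simp add: Bochner_Integration.integral_sum)
  also have "\<dots> = (\<Sum>i\<in>I. \<Sum>j\<in>I. if i = j then expectation (\<lambda>x. (W i x)\<^sup>2) else 0)"
    using orth by (intro sum.cong) (auto simp: power2_eq_square)
  finally show "expectation (\<lambda>x. (\<Sum>i\<in>I. W i x)\<^sup>2) = (\<Sum>i\<in>I. expectation (\<lambda>x. (W i x)\<^sup>2))"
    using I by simp
qed

text \<open>\<open>N\<close> carries only the sigma-algebra of the values, \<open>L\<close> is their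
  common law. Indices start at 1 as in \<open>sample_average\<close>.\<close>

locale iid_sample = prob_space S for S :: "'s measure" +
  fixes N :: "'d measure" and L :: "'d measure" and X :: "nat \<Rightarrow> 's \<Rightarrow> 'd"
  assumes indep: "indep_vars (\<lambda>_. N) X {1..}"
    and ident: "\<And>j. j \<ge> 1 \<Longrightarrow> distr S N (X j) = L"
begin

lemma X_measurable: "j \<ge> 1 \<Longrightarrow> X j \<in> measurable S N"
  using indep by (auto simp: indep_vars_def2)

lemma sets_L: "sets L = sets N"
  using ident[of 1] by auto

lemma prob_space_L: "prob_space L"
  using ident[of 1] prob_space_distr[OF X_measurable[of 1]] by simp

lemma integral_sample:
  fixes \<phi> :: "'d \<Rightarrow> real"
  assumes "j \<ge> 1" "\<phi> \<in> borel_measurable N"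
  shows "(\<integral>\<omega>. \<phi> (X j \<omega>) \<partial>S) = (\<integral>s. \<phi> s \<partial>L)"
  using integral_distr[OF X_measurable assms(2)] ident assms(1) by metis

lemma nn_integral_sample:
  assumes "j \<ge> 1" "\<phi> \<in> borel_measurable N"
  shows "(\<integral>\<^sup>+\<omega>. \<phi> (X j \<omega>) \<partial>S) = (\<integral>\<^sup>+s. \<phi> s \<partial>L)"
  unfolding ident[OF assms(1), symmetric]
  by (rule nn_integral_distr[symmetric]) (use assms X_measurable in auto)

lemma AE_sample:
  assumes "AE s in L. Q s"
  shows "AE \<omega> in S. \<forall>j\<ge>1. Q (X j \<omega>)"
proof -
  have "AE \<omega> in S. j \<ge> 1 \<longrightarrow> Q (X j \<omega>)" for j
  proof (cases "j \<ge> 1")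
    case True
    have "AE s in distr S N (X j). Q s" unfolding ident[OF True] by (rule assms)
    from AE_distrD[OF X_measurable[OF True] this] show ?thesis by simp
  qed simp
  then show ?thesis by (simp add: AE_all_countable)
qed

text \<open>
  All summands of the \<open>n\<close>-th average are truncated at the same level \<open>\<alpha>^n\<close>, so they stay identically
  distributed. \<open>V n\<close> is the squared deviation of the truncated average and \<open>E n\<close> counts the truncated
  summands; both have summable expectations by the geometric truncation bound.
\<close>

lemma slln_geometric_subsequence:
  fixes \<phi> :: "'d \<Rightarrow> real" and \<alpha> :: real
  assumes \<phi> [measurable]: "\<phi> \<in> borel_measurable N" and pos: "\<And>s. 0 \<le> \<phi> s"
    and int: "integrable L \<phi>" and \<alpha>: "\<alpha> > 1"
  shows "AE \<omega> in S. (\<lambda>n. (\<Sum>j=1..nat \<lceil>\<alpha>^n\<rceil>. \<phi> (X j \<omega>)) / real (nat \<lceil>\<alpha>^n\<rceil>)) \<longlonglongrightarrow> (\<integral>s. \<phi> s \<partial>L)"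
proof -
  interpret L: prob_space L by (rule prob_space_L)
  have setsL [measurable_cong]: "sets L = sets N" by (rule sets_L)
  define k where "k n = nat \<lceil>\<alpha>^n\<rceil>" for n
  define \<tau> where "\<tau> n s = (if \<phi> s \<le> \<alpha>^n then \<phi> s else 0)" for n s
  define \<mu> where "\<mu> n = (\<integral>s. \<tau> n s \<partial>L)" for n
  define V where "V n \<omega> = ((\<Sum>j=1..k n. \<tau> n (X j \<omega>) - \<mu> n) / real (k n))\<^sup>2" for n \<omega>
  define E where "E n \<omega> = (\<Sum>j=1..k n. if \<alpha>^n < \<phi> (X j \<omega>) then 1 else 0 :: real)" for n \<omega>
  have [measurable]: "\<tau> n \<in> borel_measurable N" for n unfolding \<tau>_def by measurable
  have [measurable]: "X j \<in> measurable S N" if "j \<in> {1..k n}" for j n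
    using that by (intro X_measurable) auto
  have \<alpha>1: "\<alpha>^n \<ge> 1" for n using \<alpha> by simp
  \<comment> \<open>Rounding up adds at most 1 \<le> \<alpha>^n, hence the factor 2.\<close>
  have k: "\<alpha>^n \<le> real (k n)" "real (k n) \<le> 2 * \<alpha>^n" for n
    using \<alpha>1[of n] unfolding k_def by linarith+
  have kpos: "real (k n) > 0" for n using k(1)[of n] \<alpha>1[of n] by linarith
  have \<tau>0: "0 \<le> \<tau> n s" and \<tau>a: "\<tau> n s \<le> \<alpha>^n" and \<tau>\<phi>: "\<tau> n s \<le> \<phi> s" for n s
    using pos[of s] \<alpha>1[of n] by (auto simp: \<tau>_def)
  have int\<tau>: "integrable L (\<tau> n)" for n
    using \<tau>0 \<tau>a by (intro L.integrable_const_bound[of _ "\<alpha>^n"]) auto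
  have int\<tau>2: "integrable L (\<lambda>s. (\<tau> n s)\<^sup>2)" for n
    using \<tau>0 \<tau>a by (intro L.integrable_const_bound[of _ "(\<alpha>^n)\<^sup>2"]) (simp_all add: power_mono)
  have \<mu>b: "0 \<le> \<mu> n" "\<mu> n \<le> \<alpha>^n" for n
    unfolding \<mu>_def using \<tau>0 \<tau>a int\<tau> L.integral_le_const[of "\<tau> n" "\<alpha>^n"]
    by (auto intro!: integral_nonneg_AE)
  have intV: "(\<integral>\<^sup>+\<omega>. ennreal (V n \<omega>) \<partial>S) \<le> (\<integral>\<^sup>+s. ennreal ((\<tau> n s)\<^sup>2 / \<alpha>^n) \<partial>L)" for n
  proof -
    define W where "W j \<omega> = \<tau> n (X j \<omega>) - \<mu> n" for j \<omega>
    have "indep_vars (\<lambda>_. N) X {1..k n}" by (rule indep_vars_subset[OF indep]) auto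
    then have ind: "indep_vars (\<lambda>_. borel) W {1..k n}"
      unfolding W_def by (rule indep_vars_compose2) measurable
    have bd: "\<bar>W j \<omega>\<bar> \<le> \<alpha>^n" for j \<omega>
      using \<tau>0[of n "X j \<omega>"] \<tau>a[of n "X j \<omega>"] \<mu>b[of n] unfolding W_def by linarith
    have mean: "expectation (W j) = 0" if "j \<in> {1..k n}" for j
    proof -
      have "expectation (W j) = (\<integral>s. \<tau> n s - \<mu> n \<partial>L)"
        unfolding W_def using that by (intro integral_sample) auto
      then show ?thesis using int\<tau> by (simp add: \<mu>_def L.prob_space)
    qed
    have var: "expectation (\<lambda>\<omega>. (W j \<omega>)\<^sup>2) \<le> (\<integral>s. (\<tau> n s)\<^sup>2 \<partial>L)" if "j \<in> {1..k n}" for j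
    proof -
      have "expectation (\<lambda>\<omega>. (W j \<omega>)\<^sup>2) = (\<integral>s. (\<tau> n s - \<mu> n)\<^sup>2 \<partial>L)"
        unfolding W_def using that by (intro integral_sample) auto
      also have "\<dots> = (\<integral>s. (\<tau> n s)\<^sup>2 \<partial>L) - (\<mu> n)\<^sup>2"
        using L.variance_eq[OF int\<tau> int\<tau>2] by (simp add: \<mu>_def)
      finally show ?thesis by simp
    qed
    have "(\<integral>\<^sup>+\<omega>. ennreal (V n \<omega>) \<partial>S) = ennreal (expectation (V n))"
      using square_sum_indep_centered(1)[OF _ ind bd mean]
      by (intro nn_integral_eq_integral) (auto simp: V_def W_def power_divide)
    also have "expectation (V n) = expectation (\<lambda>\<omega>. (\<Sum>j=1..k n. W j \<omega>)\<^sup>2) / (real (k n))\<^sup>2"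
      by (simp add: V_def[abs_def] W_def power_divide)
    also have "\<dots> = (\<Sum>j=1..k n. expectation (\<lambda>\<omega>. (W j \<omega>)\<^sup>2)) / (real (k n))\<^sup>2"
      using square_sum_indep_centered(2)[OF _ ind bd mean] by simp
    also have "\<dots> \<le> (\<Sum>j=1..k n. (\<integral>s. (\<tau> n s)\<^sup>2 \<partial>L)) / (real (k n))\<^sup>2"
      by (intro divide_right_mono sum_mono var) auto
    also have "\<dots> = (\<integral>s. (\<tau> n s)\<^sup>2 \<partial>L) / real (k n)" by (simp add: power2_eq_square)
    also have "\<dots> \<le> (\<integral>s. (\<tau> n s)\<^sup>2 \<partial>L) / \<alpha>^n"
      using k[of n] \<alpha>1[of n] by (intro divide_left_mono) (auto intro!: mult_pos_pos kpos less_le_trans[OF zero_less_one])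
    also have "\<dots> = (\<integral>s. (\<tau> n s)\<^sup>2 / \<alpha>^n \<partial>L)" by simp
    also have "ennreal \<dots> = (\<integral>\<^sup>+s. ennreal ((\<tau> n s)\<^sup>2 / \<alpha>^n) \<partial>L)"
      using int\<tau>2 \<alpha> by (intro nn_integral_eq_integral[symmetric]) auto
    finally show ?thesis by (simp add: ennreal_leI)
  qed
  have intE: "(\<integral>\<^sup>+\<omega>. ennreal (E n \<omega>) \<partial>S) \<le> (\<integral>\<^sup>+s. ennreal (if \<alpha>^n < \<phi> s then 2 * \<alpha>^n else 0) \<partial>L)" for n
  proof -
    have "(\<integral>\<^sup>+\<omega>. ennreal (E n \<omega>) \<partial>S)
        = (\<integral>\<^sup>+\<omega>. (\<Sum>j=1..k n. ennreal (if \<alpha>^n < \<phi> (X j \<omega>) then 1 else 0)) \<partial>S)"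
      unfolding E_def by (intro nn_integral_cong) (simp add: sum_ennreal)
    also have "\<dots> = (\<Sum>j=1..k n. (\<integral>\<^sup>+\<omega>. ennreal (if \<alpha>^n < \<phi> (X j \<omega>) then 1 else 0) \<partial>S))"
      by (intro nn_integral_sum) measurable
    also have "\<dots> = (\<Sum>j=1..k n. (\<integral>\<^sup>+s. ennreal (if \<alpha>^n < \<phi> s then 1 else 0) \<partial>L))"
      by (intro sum.cong refl nn_integral_sample) auto
    also have "\<dots> = ennreal (real (k n)) * (\<integral>\<^sup>+s. ennreal (if \<alpha>^n < \<phi> s then 1 else 0) \<partial>L)"
      by (simp add: ennreal_of_nat_eq_real_of_nat)
    also have "\<dots> = (\<integral>\<^sup>+s. ennreal (real (k n)) * ennreal (if \<alpha>^n < \<phi> s then 1 else 0) \<partial>L)"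
      by (intro nn_integral_cmult[symmetric]) measurable
    also have "\<dots> \<le> (\<integral>\<^sup>+s. ennreal (if \<alpha>^n < \<phi> s then 2 * \<alpha>^n else 0) \<partial>L)"
      using k(2)[of n] by (intro nn_integral_mono) (auto intro!: ennreal_leI)
    finally show ?thesis .
  qed
  have VE0: "AE \<omega> in S. (\<lambda>n. V n \<omega> + E n \<omega>) \<longlonglongrightarrow> 0"
  proof (rule AE_tendsto_zero_of_summable_integrals)
    have VE [measurable]: "V n \<in> borel_measurable S" "E n \<in> borel_measurable S" for n
      unfolding V_def[abs_def] E_def[abs_def]
      by (intro borel_measurable_power borel_measurable_divide borel_measurable_sum
            borel_measurable_diff borel_measurable_const
            measurable_compose[OF X_measurable, of _ "\<tau> n"]
            measurable_compose[OF X_measurable, of _ "\<lambda>s. if \<alpha>^n < \<phi> s then 1 else 0"]; simp)+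
    show "(\<lambda>\<omega>. V n \<omega> + E n \<omega>) \<in> borel_measurable S" for n
      by measurable
    have V0: "0 \<le> V n \<omega>" and E0: "0 \<le> E n \<omega>" for n \<omega>
      by (auto simp: V_def E_def intro!: sum_nonneg)
    then show "0 \<le> V n \<omega> + E n \<omega>" for n \<omega> by (simp add: add_nonneg_nonneg)
    have "(\<integral>\<^sup>+\<omega>. ennreal (V n \<omega> + E n \<omega>) \<partial>S)
        \<le> (\<integral>\<^sup>+s. ennreal (2 * min ((\<phi> s)\<^sup>2 / \<alpha>^n) (\<alpha>^n)) \<partial>L)" for n
    proof -
      have "(\<integral>\<^sup>+\<omega>. ennreal (V n \<omega> + E n \<omega>) \<partial>S) = (\<integral>\<^sup>+\<omega>. ennreal (V n \<omega>) + ennreal (E n \<omega>) \<partial>S)"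
        using V0 E0 by simp
      also have "\<dots> = (\<integral>\<^sup>+\<omega>. ennreal (V n \<omega>) \<partial>S) + (\<integral>\<^sup>+\<omega>. ennreal (E n \<omega>) \<partial>S)"
        by (intro nn_integral_add) measurable
      also have "\<dots> \<le> (\<integral>\<^sup>+s. ennreal ((\<tau> n s)\<^sup>2 / \<alpha>^n) \<partial>L)
          + (\<integral>\<^sup>+s. ennreal (if \<alpha>^n < \<phi> s then 2 * \<alpha>^n else 0) \<partial>L)"
        by (intro add_mono intV intE)
      also have "\<dots> = (\<integral>\<^sup>+s. ennreal ((\<tau> n s)\<^sup>2 / \<alpha>^n) + ennreal (if \<alpha>^n < \<phi> s then 2 * \<alpha>^n else 0) \<partial>L)"
        by (intro nn_integral_add[symmetric]) measurable
      also have "\<dots> \<le> (\<integral>\<^sup>+s. ennreal (2 * min ((\<phi> s)\<^sup>2 / \<alpha>^n) (\<alpha>^n)) \<partial>L)"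
      proof (intro nn_integral_mono)
        fix s
        \<comment> \<open>One of the two terms always drops out: above the level
          \<open>\<tau>\<close> is 0 and the exceedance term equals twice the minimum; otherwise
          only the square term is left, and it is the minimum.\<close>
        show "ennreal ((\<tau> n s)\<^sup>2 / \<alpha>^n) + ennreal (if \<alpha>^n < \<phi> s then 2 * \<alpha>^n else 0)
            \<le> ennreal (2 * min ((\<phi> s)\<^sup>2 / \<alpha>^n) (\<alpha>^n))"
        proof (cases "\<alpha>^n < \<phi> s")
          case True
          have "\<alpha>^n * \<alpha>^n \<le> (\<phi> s)\<^sup>2" unfolding power2_eq_square
            using True \<alpha>1[of n] by (intro mult_mono) auto
          then have "\<alpha>^n \<le> (\<phi> s)\<^sup>2 / \<alpha>^n" using \<alpha> by (simp add: pos_le_divide_eq)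
          then show ?thesis using True by (simp add: \<tau>_def min_def)
        next
          case False
          then have "(\<phi> s)\<^sup>2 \<le> \<alpha>^n * \<alpha>^n" unfolding power2_eq_square
            using pos \<alpha> by (intro mult_mono zero_le_power) auto
          then have "(\<phi> s)\<^sup>2 / \<alpha>^n \<le> \<alpha>^n" using \<alpha> by (simp add: pos_divide_le_eq)
          moreover have "0 \<le> (\<phi> s)\<^sup>2 / \<alpha>^n" using \<alpha> pos by (intro divide_nonneg_nonneg zero_le_power) auto
          then have "(\<phi> s)\<^sup>2 / \<alpha>^n \<le> 2 * ((\<phi> s)\<^sup>2 / \<alpha>^n)" by linarith
          ultimately show ?thesis using False by (simp add: \<tau>_def min_absorb1 ennreal_leI)
        qed
      qed
      finally show ?thesis .
    qed
    then have "(\<Sum>n. \<integral>\<^sup>+\<omega>. ennreal (V n \<omega> + E n \<omega>) \<partial>S)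
        \<le> (\<Sum>n. \<integral>\<^sup>+s. ennreal (2 * min ((\<phi> s)\<^sup>2 / \<alpha>^n) (\<alpha>^n)) \<partial>L)"
      by (intro suminf_le) auto
    also have "\<dots> = (\<integral>\<^sup>+s. (\<Sum>n. ennreal (2 * min ((\<phi> s)\<^sup>2 / \<alpha>^n) (\<alpha>^n))) \<partial>L)"
      by (intro nn_integral_suminf[symmetric]) measurable
    also have "\<dots> \<le> (\<integral>\<^sup>+s. ennreal (2 * (2 * \<alpha> / (\<alpha> - 1) * \<phi> s)) \<partial>L)"
    proof (intro nn_integral_mono suminf_le_const)
      fix s m
      have "(\<Sum>n<m. ennreal (2 * min ((\<phi> s)\<^sup>2 / \<alpha>^n) (\<alpha>^n)))
          = ennreal (2 * (\<Sum>n<m. min ((\<phi> s)\<^sup>2 / \<alpha>^n) (\<alpha>^n)))"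
        using \<alpha> by (subst sum_ennreal) (auto simp: sum_distrib_left)
      also have "\<dots> \<le> ennreal (2 * (2 * \<alpha> / (\<alpha> - 1) * \<phi> s))"
        using geometric_truncation_sum[OF \<alpha> pos] by (intro ennreal_leI mult_left_mono) auto
      finally show "(\<Sum>n<m. ennreal (2 * min ((\<phi> s)\<^sup>2 / \<alpha>^n) (\<alpha>^n)))
          \<le> ennreal (2 * (2 * \<alpha> / (\<alpha> - 1) * \<phi> s))" .
    qed auto
    also have "\<dots> = ennreal (\<integral>s. 2 * (2 * \<alpha> / (\<alpha> - 1) * \<phi> s) \<partial>L)"
      using int \<alpha> pos by (intro nn_integral_eq_integral) auto
    also have "\<dots> < \<infinity>" by simp
    finally show "(\<Sum>n. \<integral>\<^sup>+\<omega>. ennreal (V n \<omega> + E n \<omega>) \<partial>S) < \<infinity>" .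
  qed
  have \<mu>lim: "\<mu> \<longlonglongrightarrow> (\<integral>s. \<phi> s \<partial>L)" unfolding \<mu>_def
  proof (rule integral_dominated_convergence[where w = \<phi>])
    show "AE s in L. (\<lambda>n. \<tau> n s) \<longlonglongrightarrow> \<phi> s"
    proof (intro AE_I2)
      fix s
      have "\<forall>\<^sub>F n in sequentially. \<phi> s \<le> \<alpha>^n"
        using filterlim_at_top[of "\<lambda>n. \<alpha>^n" sequentially] filterlim_realpow_sequentially_gt1[of \<alpha>] \<alpha>
          real_arch_pow[OF \<alpha>, of "\<phi> s"]
        by (meson eventually_sequentiallyI less_imp_le order_trans power_increasing)
      then have "\<forall>\<^sub>F n in sequentially. \<tau> n s = \<phi> s" by eventually_elim (simp add: \<tau>_def)
      then show "(\<lambda>n. \<tau> n s) \<longlonglongrightarrow> \<phi> s" by (rule tendsto_eventually)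
    qed
  qed (use int \<tau>0 \<tau>\<phi> in auto)
  show ?thesis using VE0
  proof eventually_elim
    case (elim \<omega>)
    have V0: "0 \<le> V n \<omega>" and E0: "0 \<le> E n \<omega>" for n
      by (auto simp: V_def E_def intro!: sum_nonneg)
    have "(\<lambda>n. V n \<omega>) \<longlonglongrightarrow> 0"
      by (rule tendsto_sandwich[OF _ _ tendsto_const elim]) (use V0 E0 in auto)
    then have "(\<lambda>n. sqrt (V n \<omega>)) \<longlonglongrightarrow> 0" using tendsto_real_sqrt by fastforce
    then have "(\<lambda>n. (\<Sum>j=1..k n. \<tau> n (X j \<omega>) - \<mu> n) / real (k n)) \<longlonglongrightarrow> 0"
      by (simp only: V_def real_sqrt_abs tendsto_rabs_zero_iff)
    then have "(\<lambda>n. (\<Sum>j=1..k n. \<tau> n (X j \<omega>) - \<mu> n) / real (k n) + \<mu> n) \<longlonglongrightarrow> 0 + (\<integral>s. \<phi> s \<partial>L)"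
      by (rule tendsto_add) (rule \<mu>lim)
    \<comment> \<open>\<open>E n\<close> is a count, so once it is below 1 no summand is truncated
      and the two averages coincide.\<close>
    moreover have "\<forall>\<^sub>F n in sequentially. (\<Sum>j=1..k n. \<tau> n (X j \<omega>) - \<mu> n) / real (k n) + \<mu> n
        = (\<Sum>j=1..k n. \<phi> (X j \<omega>)) / real (k n)"
      using order_tendstoD(2)[OF elim, of 1, OF zero_less_one]
    proof eventually_elim
      case (elim n)
      then have "E n \<omega> < 1" using V0[of n] by simp
      have "\<phi> (X j \<omega>) \<le> \<alpha>^n" if "j \<in> {1..k n}" for j
      proof (rule ccontr)
        assume "\<not> \<phi> (X j \<omega>) \<le> \<alpha>^n"
        then have "1 = (if \<alpha>^n < \<phi> (X j \<omega>) then 1 else 0 :: real)" by simp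
        also have "\<dots> \<le> E n \<omega>" unfolding E_def using that by (intro member_le_sum) auto
        finally show False using \<open>E n \<omega> < 1\<close> by simp
      qed
      then have "(\<Sum>j=1..k n. \<tau> n (X j \<omega>)) = (\<Sum>j=1..k n. \<phi> (X j \<omega>))"
        by (intro sum.cong) (auto simp: \<tau>_def)
      then show ?case using kpos[of n] by (simp add: sum_subtractf diff_divide_distrib)
    qed
    ultimately show ?case unfolding k_def by (simp add: tendsto_cong)
  qed
qed

text \<open>Nonnegativity makes the partial sums monotone, as the interpolation requires. The ratios
  1 + 1/(m+1) are countably many, so one null set serves all of them.\<close>

lemma slln_nonneg:
  fixes \<phi> :: "'d \<Rightarrow> real"
  assumes \<phi> [measurable]: "\<phi> \<in> borel_measurable N" and pos: "\<And>s. 0 \<le> \<phi> s" and int: "integrable L \<phi>"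
  shows "AE \<omega> in S. (\<lambda>n. (\<Sum>j=1..n. \<phi> (X j \<omega>)) / real n) \<longlonglongrightarrow> (\<integral>s. \<phi> s \<partial>L)"
proof -
  have "AE \<omega> in S. \<forall>m. (\<lambda>n. (\<Sum>j=1..nat \<lceil>(1 + 1 / real (Suc m))^n\<rceil>. \<phi> (X j \<omega>))
      / real (nat \<lceil>(1 + 1 / real (Suc m))^n\<rceil>)) \<longlonglongrightarrow> (\<integral>s. \<phi> s \<partial>L)"
    unfolding AE_all_countable by (intro allI slln_geometric_subsequence assms) auto
  then show ?thesis
  proof eventually_elim
    case (elim \<omega>)
    show ?case
    proof (rule average_tendsto_of_geometric_subsequences)
      show "mono (\<lambda>n. \<Sum>j=1..n. \<phi> (X j \<omega>))" using pos by (intro monoI sum_mono2) auto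
    qed (use elim pos in \<open>auto intro!: sum_nonneg integral_nonneg_AE\<close>)
  qed
qed

lemma slln_real:
  fixes \<phi> :: "'d \<Rightarrow> real"
  assumes [measurable]: "\<phi> \<in> borel_measurable N" and int: "integrable L \<phi>"
  shows "AE \<omega> in S. (\<lambda>n. (\<Sum>j=1..n. \<phi> (X j \<omega>)) / real n) \<longlonglongrightarrow> (\<integral>s. \<phi> s \<partial>L)"
proof -
  have split: "\<phi> s = max 0 (\<phi> s) - max 0 (- \<phi> s)" for s by auto
  have i: "integrable L (\<lambda>s. max 0 (\<phi> s))" "integrable L (\<lambda>s. max 0 (- \<phi> s))" using int by auto
  have eq: "(\<integral>s. \<phi> s \<partial>L) = (\<integral>s. max 0 (\<phi> s) \<partial>L) - (\<integral>s. max 0 (- \<phi> s) \<partial>L)"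
    unfolding Bochner_Integration.integral_diff[OF i, symmetric] by (simp flip: split)
  have "AE \<omega> in S. (\<lambda>n. (\<Sum>j=1..n. max 0 (\<phi> (X j \<omega>))) / real n) \<longlonglongrightarrow> (\<integral>s. max 0 (\<phi> s) \<partial>L)"
    "AE \<omega> in S. (\<lambda>n. (\<Sum>j=1..n. max 0 (- \<phi> (X j \<omega>))) / real n) \<longlonglongrightarrow> (\<integral>s. max 0 (- \<phi> s) \<partial>L)"
    by (rule slln_nonneg; use i in simp)+
  then show ?thesis
  proof eventually_elim
    case (elim \<omega>)
    have "(\<Sum>j=1..n. \<phi> (X j \<omega>)) / real n = (\<Sum>j=1..n. max 0 (\<phi> (X j \<omega>))) / real n
        - (\<Sum>j=1..n. max 0 (- \<phi> (X j \<omega>))) / real n" for n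
      by (subst split) (simp only: sum_subtractf diff_divide_distrib)
    then show ?case using tendsto_diff[OF elim] by (simp add: eq)
  qed
qed

lemma slln_vec:
  fixes \<phi> :: "'d \<Rightarrow> real^'p"
  assumes [measurable]: "\<phi> \<in> borel_measurable N" and int: "integrable L \<phi>"
  shows "AE \<omega> in S. (\<lambda>\<nu>. sample_average \<nu> (\<lambda>j. X j \<omega>) \<phi>) \<longlonglongrightarrow> (\<integral>s. \<phi> s \<partial>L)"
proof -
  have "AE \<omega> in S. \<forall>i. (\<lambda>n. (\<Sum>j=1..n. \<phi> (X j \<omega>) $ i) / real n) \<longlonglongrightarrow> (\<integral>s. \<phi> s $ i \<partial>L)"
    unfolding AE_all_countable
    by (intro allI slln_real integrable_bounded_linear[OF bounded_linear_vec_nth int]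
          measurable_compose[OF assms(1) borel_measurable_continuous_onI[OF continuous_on_component]]
          continuous_on_id)
  then show ?thesis
  proof eventually_elim
    case (elim \<omega>)
    show ?case
    proof (rule vec_tendstoI)
      fix i
      show "(\<lambda>\<nu>. sample_average \<nu> (\<lambda>j. X j \<omega>) \<phi> $ i) \<longlonglongrightarrow> (\<integral>s. \<phi> s \<partial>L) $ i"
        using elim[rule_format, of i]
        unfolding integral_bounded_linear[OF bounded_linear_vec_nth int]
        by (simp add: sample_average_def)
    qed
  qed
qed

end

section \<open>Controllability of the implicit Euler scheme\<close>

text \<open>D D^T x = 0 forces |D^T x|^2 = 0, and a transposed right inverse of \<open>D\<close>
  cancels D^T, so D D^T is invertible. The identity lets a feedback control meet the mixed
  constraint with equality.\<close>

lemma pseudoinverse_right_inverse: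
  fixes D :: "real^'m^'l"
  assumes "rank D = CARD('l)"
  shows "D ** pseudoinverse D = mat 1"
proof -
  obtain R where R: "D ** R = mat 1"
    using assms by (metis full_rank_surjective matrix_right_invertible_surjective)
  have "x = 0" if "(D ** transpose D) *v x = 0" for x
  proof -
    have "inner (transpose D *v x) (transpose D *v x) = inner x ((D ** transpose D) *v x)"
      unfolding matrix_vector_mul_assoc[symmetric] dot_lmul_matrix[symmetric] by simp
    then have "transpose D *v x = 0" using that by simp
    then have "transpose R *v (transpose D *v x) = 0" by simp
    then show ?thesis
      by (simp only: matrix_vector_mul_assoc matrix_transpose_mul[symmetric] R transpose_mat matrix_vector_mul_lid)
  qed
  then have "invertible (D ** transpose D)"
    by (metis invertible_left_inverse matrix_left_invertible_ker)
  then have "(D ** transpose D) ** matrix_inv (D ** transpose D) = mat 1"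
    unfolding invertible_def matrix_inv_def by (metis (mono_tags, lifting) someI_ex)
  then show ?thesis by (simp add: pseudoinverse_full_row_rank[OF assms] matrix_mul_assoc)
qed

text \<open>The states reachable from the origin in \<open>N\<close> steps with matrix
  \<open>W\<close> and input matrix \<open>G\<close>. Explicit sums instead of a span keep the
  inputs available as controls.\<close>

definition reach :: "real^'n^'n \<Rightarrow> real^'k^'n \<Rightarrow> nat \<Rightarrow> (real^'n) set" where
  "reach W G N = {\<Sum>j<N. mat_pow W j *v (G *v v j) | v. True}"

lemma mat_pow_0: "mat_pow W 0 = mat 1"
  by (simp add: mat_pow_def)

lemma mat_pow_Suc: "mat_pow W (Suc k) = W ** mat_pow W k"
  by (simp add: mat_pow_def)

lemma reachI: "(\<Sum>j<N. mat_pow W j *v (G *v v j)) \<in> reach W G N"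
  by (auto simp: reach_def)

lemma subspace_reach: "subspace (reach W G N)"
proof (rule subspaceI)
  show "0 \<in> reach W G N" using reachI[of W G "\<lambda>_. 0" N] by simp
next
  fix x y assume "x \<in> reach W G N" "y \<in> reach W G N"
  then obtain v w where "x = (\<Sum>j<N. mat_pow W j *v (G *v v j))" "y = (\<Sum>j<N. mat_pow W j *v (G *v w j))"
    by (auto simp: reach_def)
  then have "x + y = (\<Sum>j<N. mat_pow W j *v (G *v (v j + w j)))"
    by (simp add: sum.distrib matrix_vector_right_distrib)
  then show "x + y \<in> reach W G N" by (simp only: reachI)
next
  fix c x assume "x \<in> reach W G N"
  then obtain v where "x = (\<Sum>j<N. mat_pow W j *v (G *v v j))" by (auto simp: reach_def)
  then have "c *\<^sub>R x = (\<Sum>j<N. mat_pow W j *v (G *v (c *\<^sub>R v j)))"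
    by (simp add: scaleR_sum_right matrix_vector_mult_scaleR)
  then show "c *\<^sub>R x \<in> reach W G N" by (simp only: reachI)
qed

lemma reach_mono: assumes "N \<le> N'" shows "reach W G N \<subseteq> reach W G N'"
proof
  fix x assume "x \<in> reach W G N"
  then obtain v where v: "x = (\<Sum>j<N. mat_pow W j *v (G *v v j))" by (auto simp: reach_def)
  have "(\<Sum>j<N'. mat_pow W j *v (G *v (if j < N then v j else 0))) = x"
    unfolding v using assms by (intro sum.mono_neutral_cong_right) auto
  then show "x \<in> reach W G N'" using reachI by metis
qed

lemma reach_mult: assumes "x \<in> reach W G N" shows "W *v x \<in> reach W G (Suc N)"
proof -
  obtain v where v: "x = (\<Sum>j<N. mat_pow W j *v (G *v v j))" using assms by (auto simp: reach_def)
  define v' where "v' j = (case j of 0 \<Rightarrow> 0 | Suc i \<Rightarrow> v i)" for j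
  have "W *v x = (\<Sum>j<N. W *v (mat_pow W j *v (G *v v j)))"
    unfolding v by (rule linear_sum[OF matrix_vector_mul_linear])
  also have "\<dots> = (\<Sum>j<Suc N. mat_pow W j *v (G *v v' j))"
    by (subst sum.lessThan_Suc_shift) (simp add: v'_def mat_pow_Suc matrix_vector_mul_assoc matrix_mul_assoc)
  finally show ?thesis by (simp only: reachI)
qed

lemma mult_mem_reach: "G *v v \<in> reach W G (Suc 0)"
  using reachI[of W G "\<lambda>_. v" "Suc 0"] by (simp add: mat_pow_0)

text \<open>A preimage under the block matrix, cut into blocks, is the list of inputs;
  \<open>to_nat_on\<close> turns block labels into exponents.\<close>

lemma reach_krylov_full_rank:
  fixes H :: "real^'n^'n" and G :: "real^'k^'n"
  assumes "rank (krylov_matrix H G) = CARD('n)"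
  shows "reach H G CARD('n) = UNIV"
proof -
  have bij: "bij_betw (to_nat_on (UNIV::'n set)) UNIV {..<CARD('n)}"
    by (rule to_nat_on_finite) simp
  define ix where "ix = inv_into UNIV (to_nat_on (UNIV::'n set))"
  have ix: "ix (to_nat_on UNIV b) = b" for b :: 'n
    unfolding ix_def using bij by (simp add: bij_betw_def inv_into_f_f)
  have "y \<in> reach H G CARD('n)" for y
  proof -
    obtain x where x: "y = krylov_matrix H G *v x"
      using assms full_rank_surjective[of "krylov_matrix H G"] by (metis surjD)
    define w where "w b = (\<chi> c. x $ (b, c))" for b
    have "y = (\<Sum>b\<in>UNIV. mat_pow H (to_nat_on UNIV b) *v (G *v w b))"
    proof (rule vec_eq_iff[THEN iffD2], rule allI)
      fix i
      have "y $ i = (\<Sum>p\<in>UNIV \<times> UNIV. (mat_pow H (to_nat_on UNIV (fst p)) ** G) $ i $ snd p * x $ p)"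
        unfolding x by (simp add: matrix_vector_mult_def krylov_matrix_def UNIV_Times_UNIV)
      also have "\<dots> = (\<Sum>b\<in>UNIV. \<Sum>c\<in>UNIV. (mat_pow H (to_nat_on UNIV b) ** G) $ i $ c * x $ (b, c))"
        by (simp add: sum.cartesian_product case_prod_beta)
      also have "\<dots> = (\<Sum>b\<in>UNIV. ((mat_pow H (to_nat_on UNIV b) ** G) *v w b) $ i)"
        by (simp add: matrix_vector_mult_def w_def)
      finally show "y $ i = (\<Sum>b\<in>UNIV. mat_pow H (to_nat_on UNIV b) *v (G *v w b)) $ i"
        by (simp add: matrix_vector_mul_assoc)
    qed
    also have "\<dots> = (\<Sum>b\<in>(UNIV::'n set). mat_pow H (to_nat_on UNIV b) *v (G *v w (ix (to_nat_on UNIV b))))"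
      by (simp add: ix)
    also have "\<dots> = (\<Sum>j<CARD('n). mat_pow H j *v (G *v w (ix j)))"
      by (rule sum.reindex_bij_betw[OF bij, of "\<lambda>j. mat_pow H j *v (G *v w (ix j))"])
    finally show ?thesis by (simp only: reachI)
  qed
  then show ?thesis by blast
qed

text \<open>Since H = (1 - W)/h, each H^k G v is a polynomial of degree k in W applied to G v. The
  Krylov space of H is thus contained in that of W for every nonzero h, small or not.\<close>

lemma reach_implicit_step:
  fixes H :: "real^'n^'n" and G :: "real^'k^'n"
  assumes h: "h \<noteq> 0" and rank: "rank (krylov_matrix H G) = CARD('n)" and N: "CARD('n) \<le> N"
  shows "reach (mat 1 - h *\<^sub>R H) G N = UNIV"
proof -
  define W where "W = mat 1 - h *\<^sub>R H"
  have pow: "mat_pow H k *v (G *v v) \<in> reach W G (Suc k)" for k v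
  proof (induction k)
    case 0
    then show ?case using mult_mem_reach by (simp add: mat_pow_0)
  next
    case (Suc k)
    let ?s = "mat_pow H k *v (G *v v)"
    have "W *v ?s = ?s - h *\<^sub>R (H *v ?s)"
      by (simp add: W_def matrix_vector_mult_diff_rdistrib scaleR_matrix_vector_assoc[symmetric])
    then have "mat_pow H (Suc k) *v (G *v v) = (1 / h) *\<^sub>R (?s - W *v ?s)"
      using h by (simp add: mat_pow_Suc matrix_vector_mul_assoc matrix_mul_assoc)
    moreover have "?s \<in> reach W G (Suc (Suc k))" using Suc reach_mono[of "Suc k" "Suc (Suc k)"] by auto
    ultimately show ?case
      using reach_mult[OF Suc] by (simp add: subspace_reach subspace_diff subspace_scale)
  qed
  have "y \<in> reach W G N" for y
  proof -
    have "y \<in> reach H G CARD('n)" using reach_krylov_full_rank[OF rank] by simp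
    then obtain v where "y = (\<Sum>j<CARD('n). mat_pow H j *v (G *v v j))" by (auto simp: reach_def)
    moreover have "mat_pow H j *v (G *v v j) \<in> reach W G N" if "j < CARD('n)" for j
      using pow[of j "v j"] reach_mono[of "Suc j" N W G] that N by auto
    ultimately show ?thesis by (auto intro!: subspace_sum subspace_reach)
  qed
  then show ?thesis unfolding W_def by blast
qed

text \<open>The discrete variation of constants formula, with the forcing listed from the most
  recent step back.\<close>

lemma backward_recursion:
  fixes y :: "nat \<Rightarrow> real^'n"
  assumes "\<And>k. y (Suc k) = W *v y k - b k"
  shows "y k = mat_pow W k *v y 0 - (\<Sum>j<k. mat_pow W j *v b (k - Suc j))"
proof (induction k)
  case 0
  then show ?case by (simp add: mat_pow_0)
next
  case (Suc k)
  have "y (Suc k) = mat_pow W (Suc k) *v y 0 - ((\<Sum>j<k. W *v (mat_pow W j *v b (k - Suc j))) + b k)"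
    unfolding assms Suc
    by (simp add: matrix_vector_mult_diff_distrib linear_sum[OF matrix_vector_mul_linear]
        mat_pow_Suc matrix_vector_mul_assoc)
  also have "(\<Sum>j<k. W *v (mat_pow W j *v b (k - Suc j))) + b k = (\<Sum>j<Suc k. mat_pow W j *v b (Suc k - Suc j))"
    by (subst sum.lessThan_Suc_shift) (simp add: mat_pow_0 mat_pow_Suc matrix_vector_mul_assoc matrix_mul_assoc)
  finally show ?case .
qed

text \<open>
  Run backwards from the target, the implicit Euler scheme becomes explicit, so no invertibility
  of \<open>mat 1 - h *\<^sub>R H\<close> is needed.
\<close>

lemma implicit_euler_controllable:
  fixes H :: "real^'n^'n" and G :: "real^'k^'n" and b :: "nat \<Rightarrow> real^'n"
  assumes h: "h \<noteq> 0" and rank: "rank (krylov_matrix H G) = CARD('n)" and N: "CARD('n) \<le> N"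
  obtains x v where "x 0 = x0" "x N = x1"
    "\<And>i. i < N \<Longrightarrow> x (Suc i) - x i = h *\<^sub>R (H *v x (Suc i)) + h *\<^sub>R (G *v v (Suc i) + b (Suc i))"
proof -
  define W where "W = mat 1 - h *\<^sub>R H"
  \<comment> \<open>Inputs enter the scheme with a factor \<open>h\<close>, so the defect is divided
    by \<open>h\<close> before it is represented.\<close>
  have "(1 / h) *\<^sub>R (mat_pow W N *v x1 - x0 - (\<Sum>j<N. mat_pow W j *v (h *\<^sub>R b (Suc j)))) \<in> reach W G N"
    using reach_implicit_step[OF assms] by (simp add: W_def)
  then obtain w where "(1 / h) *\<^sub>R (mat_pow W N *v x1 - x0 - (\<Sum>j<N. mat_pow W j *v (h *\<^sub>R b (Suc j))))
      = (\<Sum>j<N. mat_pow W j *v (G *v w j))" by (auto simp: reach_def)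
  then have "h *\<^sub>R (1 / h) *\<^sub>R (mat_pow W N *v x1 - x0 - (\<Sum>j<N. mat_pow W j *v (h *\<^sub>R b (Suc j))))
      = h *\<^sub>R (\<Sum>j<N. mat_pow W j *v (G *v w j))" by (rule arg_cong)
  then have "mat_pow W N *v x1 - x0 - (\<Sum>j<N. mat_pow W j *v (h *\<^sub>R b (Suc j)))
      = h *\<^sub>R (\<Sum>j<N. mat_pow W j *v (G *v w j))" using h by simp
  then have w: "mat_pow W N *v x1 - (\<Sum>j<N. mat_pow W j *v (h *\<^sub>R (G *v w j + b (Suc j)))) = x0"
    by (simp add: scaleR_sum_right matrix_vector_mult_scaleR matrix_vector_right_distrib
        sum.distrib scaleR_add_right algebra_simps)
  \<comment> \<open>Backward step \<open>k\<close> undoes forward step N - k, so the inputs are read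
    in reverse; \<open>w\<close> counts from 0, \<open>b\<close> from 1.\<close>
  define e where "e k = h *\<^sub>R (G *v w (N - Suc k) + b (N - k))" for k
  define y where "y = rec_nat x1 (\<lambda>k z. W *v z - e k)"
  have y: "y 0 = x1" "y (Suc k) = W *v y k - e k" for k by (simp_all add: y_def)
  have "(\<Sum>j<N. mat_pow W j *v e (N - Suc j)) = (\<Sum>j<N. mat_pow W j *v (h *\<^sub>R (G *v w j + b (Suc j))))"
    by (intro sum.cong) (auto simp: e_def Suc_diff_Suc)
  then have yN: "y N = x0" using backward_recursion[of y W e N, OF y(2)] w y(1) by simp
  show ?thesis
  proof
    \<comment> \<open>The forward states are x_i = y (N - i), the controls v_j = w (j - 1).\<close>
    show "y (N - 0) = x0" "y (N - N) = x1" using yN y by simp_all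
    fix i assume i: "i < N"
    define k where "k = N - Suc i"
    have k: "N - i = Suc k" "N - k = Suc i" "N - Suc k = i" using i by (auto simp: k_def)
    have "y (Suc k) = y k - h *\<^sub>R (H *v y k) - h *\<^sub>R (G *v w i + b (Suc i))"
      unfolding y by (simp add: e_def k W_def matrix_vector_mult_diff_rdistrib scaleR_matrix_vector_assoc[symmetric])
    then show "y (N - Suc i) - y (N - i) = h *\<^sub>R (H *v y (N - Suc i)) + h *\<^sub>R (G *v w (Suc i - 1) + b (Suc i))"
      unfolding k k_def[symmetric] by simp
  qed
qed

text \<open>In the feedback u = D^+ (f - Cx) + Yv the first term enforces equality because D D^+ =
  1, and the second is invisible to the constraint because DY = 0. What remains is an unconstrained
  scheme with matrix A - B D^+ C, input matrix BY and forcing B D^+ f.\<close>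

lemma constrained_implicit_euler_controllable:
  fixes A :: "real^'n^'n" and B :: "real^'m^'n" and C :: "real^'n^'l" and D :: "real^'m^'l"
    and Y :: "real^'k^'m" and f :: "nat \<Rightarrow> real^'l"
  assumes D: "rank D = CARD('l)" and DY: "D ** Y = 0"
    and rank: "rank (krylov_matrix (A - B ** pseudoinverse D ** C) (B ** Y)) = CARD('n)"
    and h: "h \<noteq> 0" and N: "CARD('n) \<le> N"
  obtains x u where "x 0 = x0" "x N = x1"
    "\<And>i. i < N \<Longrightarrow> x (Suc i) - x i = h *\<^sub>R (A *v x (Suc i)) + h *\<^sub>R (B *v u (Suc i))"
    "\<And>i. C *v x i + D *v u i = f i"
proof -
  let ?X = "pseudoinverse D"
  define H where "H = A - B ** ?X ** C"
  obtain x v where x: "x 0 = x0" "x N = x1"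
    "\<And>i. i < N \<Longrightarrow> x (Suc i) - x i
        = h *\<^sub>R (H *v x (Suc i)) + h *\<^sub>R ((B ** Y) *v v (Suc i) + B *v (?X *v f (Suc i)))"
    using implicit_euler_controllable[of h H "B ** Y" N x0 x1 "\<lambda>i. B *v (?X *v f i)"] assms
    unfolding H_def by metis
  define u where "u i = ?X *v (f i - C *v x i) + Y *v v i" for i
  show ?thesis
  proof
    show "x 0 = x0" "x N = x1" by fact+
    show "C *v x i + D *v u i = f i" for i
      unfolding u_def
      by (simp add: matrix_vector_right_distrib matrix_vector_mul_assoc DY pseudoinverse_right_inverse[OF D])
    fix i assume "i < N"
    have "A *v z + B *v (?X *v (g - C *v z) + Y *v w) = H *v z + ((B ** Y) *v w + B *v (?X *v g))" for z g w
      by (simp add: H_def matrix_vector_right_distrib matrix_vector_mult_diff_distrib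
          matrix_vector_mult_diff_rdistrib matrix_vector_mul_assoc[symmetric])
    then show "x (Suc i) - x i = h *\<^sub>R (A *v x (Suc i)) + h *\<^sub>R (B *v u (Suc i))"
      unfolding x(3)[OF \<open>i < N\<close>] u_def scaleR_add_right[symmetric] by simp
  qed
qed

section \<open>Existence of minimisers\<close>

text \<open>Tychonoff's theorem. Candidates are functions on all indices, so the product topology is
  used, for which coordinates are continuous.\<close>

lemma compact_function_box:
  fixes a :: "'i \<Rightarrow> real"
  shows "compact {x :: 'i \<Rightarrow> 'v::euclidean_space. \<forall>i. norm (x i) \<le> a i}"
proof -
  have "compactin (product_topology (\<lambda>i. euclidean) UNIV) (PiE UNIV (\<lambda>i. cball (0::'v) (a i)))"
    by (subst compactin_PiE) auto
  then show ?thesis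
    by (simp add: euclidean_product_topology PiE_UNIV_domain Pi_def)
qed

lemma continuous_on_fst_coordinate [continuous_intros]:
  "continuous_on UNIV (\<lambda>p :: ('i \<Rightarrow> 'a::topological_space) \<times> 'b::topological_space. fst p i)"
  by (rule continuous_on_compose2[OF continuous_on_product_coordinates continuous_on_fst])
    (auto intro: continuous_on_id)

lemma continuous_on_snd_coordinate [continuous_intros]:
  "continuous_on UNIV (\<lambda>p :: 'b::topological_space \<times> ('i \<Rightarrow> 'a::topological_space). snd p i)"
  by (rule continuous_on_compose2[OF continuous_on_product_coordinates continuous_on_snd])
    (auto intro: continuous_on_id)

lemma continuous_on_matrix_vector_mult [continuous_intros]:
  fixes A :: "real^'n^'m"
  shows "continuous_on S f \<Longrightarrow> continuous_on S (\<lambda>p. A *v f p)"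
  by (rule bounded_linear.continuous_on[OF matrix_vector_mul_bounded_linear])

lemma closed_Collect_ball: "(\<And>i. i \<in> I \<Longrightarrow> closed {p. R i p}) \<Longrightarrow> closed {p. \<forall>i\<in>I. R i p}"
  unfolding Collect_ball_eq by (rule closed_INT) simp

lemma square_le_imp_le_1_plus: "a\<^sup>2 \<le> r \<Longrightarrow> a \<le> 1 + (r::real)"
  using sum_squares_ge_zero[of "a - 1" a] by (simp add: power2_eq_square algebra_simps)

text \<open>
  For fixed sample and step size the tracking term makes the objective coercive: the Lipschitz
  terminal cost is absorbed by half of the quadratic penalty at the final time.
\<close>

lemma time_stepping_optimal_exists:
  fixes F :: "real^'n \<Rightarrow> real^'d \<Rightarrow> real" and g :: "real^'n \<Rightarrow> real^'d \<Rightarrow> real^'p"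
    and B :: "real^'m^'n" and D :: "real^'m^'l"
  assumes T: "T > 0" and \<delta>: "\<delta> > 0" and N: "N > 0"
    and lip: "\<And>z1 z2. \<bar>sample_average \<nu> s (F z1) - sample_average \<nu> s (F z2)\<bar> \<le> c * norm (z1 - z2)"
    and cF: "continuous_on UNIV (\<lambda>z. sample_average \<nu> s (F z))"
    and cg: "continuous_on UNIV (\<lambda>z. sample_average \<nu> s (g z))"
    and p0: "time_stepping_feasible A B C D x0 f M q g K \<epsilon> T N \<nu> s p0"
  shows "\<exists>xu. time_stepping_optimal A B C D x0 f xd ud \<delta> F M q g K \<epsilon> T N \<nu> s xu"
proof -
  define h where "h = T / real N"
  have h: "h > 0" using T N by (simp add: h_def)
  define feas where "feas = time_stepping_feasible A B C D x0 f M q g K \<epsilon> T N \<nu> s"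
  define obj where "obj = time_stepping_objective F xd ud \<delta> T N \<nu> s"
  define Fs where "Fs z = sample_average \<nu> s (F z)" for z
  define Q where "Q p = (\<Sum>i=1..N. (norm (fst p i - xd (real i * h)))\<^sup>2 + \<delta> * (norm (snd p i - ud (real i * h)))\<^sup>2)"
    for p :: "(nat \<Rightarrow> real^'n) \<times> (nat \<Rightarrow> real^'m)"
  have obj: "obj p = Fs (fst p N) + h / 2 * Q p" for p
    by (cases p) (simp add: obj_def time_stepping_objective_def Fs_def Q_def h_def Let_def)
  have feas: "feas p \<longleftrightarrow> fst p 0 = x0 \<and>
      (\<forall>i\<in>{..<N}. fst p (Suc i) - fst p i = h *\<^sub>R (A *v fst p (Suc i)) + h *\<^sub>R (B *v snd p (Suc i)) \<and>
         (\<forall>k. (C *v fst p (Suc i) + D *v snd p (Suc i) - f (real (Suc i) * h)) $ k \<le> 0)) \<and>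
      norm (vec_min (fst p N) (sample_average \<nu> s (\<lambda>\<xi>. M \<xi> *v fst p N + q \<xi>))) \<le> \<epsilon> \<and>
      infdist (sample_average \<nu> s (g (fst p N))) K \<le> \<epsilon>" for p
    by (cases p) (simp add: feas_def time_stepping_feasible_def h_def Let_def less_eq_vec_def Ball_def)
  have cN: "continuous_on UNIV (\<lambda>p :: (nat \<Rightarrow> real^'n) \<times> (nat \<Rightarrow> real^'m). \<phi> (fst p N))"
    if "continuous_on UNIV \<phi>" for \<phi> :: "real^'n \<Rightarrow> 'z::topological_space"
    by (rule continuous_on_compose2[OF that continuous_on_fst_coordinate]) auto
  have cobj: "continuous_on UNIV obj"
    unfolding obj[abs_def] Q_def Fs_def by (intro continuous_intros cN cF)
  have cmin: "continuous_on UNIV (\<lambda>z. norm (vec_min z (sample_average \<nu> s (\<lambda>\<xi>. M \<xi> *v z + q \<xi>))))"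
    unfolding vec_min_def sample_average_def
    by (intro continuous_on_norm continuous_on_vec_lambda continuous_on_min continuous_on_component
          continuous_on_scaleR continuous_on_sum continuous_on_add continuous_on_matrix_vector_mult
          continuous_on_id continuous_on_const)
  have cdist: "continuous_on UNIV (\<lambda>z. infdist (sample_average \<nu> s (g z)) K)"
    by (intro continuous_on_infdist cg)
  have "closed {p. feas p}" unfolding feas
    by (intro closed_Collect_conj closed_Collect_ball closed_Collect_all closed_Collect_eq
          closed_Collect_le cN[OF cmin] cN[OF cdist] continuous_on_component continuous_on_diff
          continuous_on_add continuous_on_scaleR continuous_on_matrix_vector_mult
          continuous_on_fst_coordinate continuous_on_snd_coordinate continuous_on_const)
  \<comment> \<open>Coordinates that the problem ignores are arbitrary; setting them to zero brings
    a candidate into a compact box.\<close>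
  define nz where "nz p = (\<lambda>i. if i \<le> N then fst p i else 0, \<lambda>i. if i \<in> {1..N} then snd p i else 0)"
    for p :: "(nat \<Rightarrow> real^'n) \<times> (nat \<Rightarrow> real^'m)"
  have objnz: "obj (nz p) = obj p" for p
    unfolding obj Q_def by (auto simp: nz_def intro!: sum.cong)
  have feasnz: "feas (nz p) = feas p" for p
    unfolding feas by (auto simp: nz_def)
  \<comment> \<open>\<open>max\<close> makes the constant nonnegative. With a the final tracking
    error, L a \<le> (h/4) a^2 + L^2/h leaves h/4 of \<open>Q\<close> in the objective; solving obj
    p \<le> obj p0 for \<open>Q p\<close> gives the bound \<open>r\<close>.\<close>
  define L where "L = max 0 c"
  define r where "r = 4 / h * (obj p0 - Fs (xd (real N * h)) + L\<^sup>2 / h)"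
  \<comment> \<open>The radii use a \<le> 1 + a^2 in place of square roots; \<open>norm x0\<close>
    serves index 0, which \<open>Q\<close> does not control.\<close>
  define Bx where "Bx = {x :: nat \<Rightarrow> real^'n. \<forall>i. norm (x i) \<le> norm x0 + norm (xd (real i * h)) + (1 + \<bar>r\<bar>)}
    \<times> {u :: nat \<Rightarrow> real^'m. \<forall>i. norm (u i) \<le> norm (ud (real i * h)) + (1 + \<bar>r / \<delta>\<bar>)}"
  have inB: "nz p \<in> Bx" if p: "feas p" and le: "obj p \<le> obj p0" for p
  proof -
    define a where "a = norm (fst p N - xd (real N * h))"
    have Qt: "(norm (fst p i - xd (real i * h)))\<^sup>2 + \<delta> * (norm (snd p i - ud (real i * h)))\<^sup>2 \<le> Q p"
      if "i \<in> {1..N}" for i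
      unfolding Q_def using \<delta> that by (intro member_le_sum) auto
    have Qx: "(norm (fst p i - xd (real i * h)))\<^sup>2 \<le> Q p"
      and Qu: "\<delta> * (norm (snd p i - ud (real i * h)))\<^sup>2 \<le> Q p" if "i \<in> {1..N}" for i
    proof -
      have "0 \<le> \<delta> * (norm (snd p i - ud (real i * h)))\<^sup>2" using \<delta> by simp
      then show "(norm (fst p i - xd (real i * h)))\<^sup>2 \<le> Q p" using Qt[OF that] by linarith
      have "0 \<le> (norm (fst p i - xd (real i * h)))\<^sup>2" by simp
      then show "\<delta> * (norm (snd p i - ud (real i * h)))\<^sup>2 \<le> Q p" using Qt[OF that] by linarith
    qed
    have "Fs (xd (real N * h)) - Fs (fst p N) \<le> c * a"
      using lip[of "fst p N" "xd (real N * h)"] by (simp add: Fs_def a_def abs_le_iff)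
    also have "\<dots> \<le> L * a" by (intro mult_right_mono) (auto simp: L_def a_def)
    also have "\<dots> \<le> h / 4 * a\<^sup>2 + L\<^sup>2 / h"
    proof -
      have "0 \<le> (h * a / 2 - L)\<^sup>2 / h" using h by simp
      also have "\<dots> = h / 4 * a\<^sup>2 + L\<^sup>2 / h - L * a"
        using h by (simp add: power2_eq_square field_simps)
      finally show ?thesis by simp
    qed
    also have "\<dots> \<le> h / 4 * Q p + L\<^sup>2 / h"
      using Qx[of N] N h by (auto simp: a_def)
    finally have "Fs (xd (real N * h)) - Fs (fst p N) \<le> h / 4 * Q p + L\<^sup>2 / h" .
    moreover have "h / 2 * Q p = 2 * (h / 4 * Q p)" by simp
    ultimately have "h / 4 * Q p \<le> obj p0 - Fs (xd (real N * h)) + L\<^sup>2 / h"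
      using le unfolding obj[of p] by linarith
    then have "4 / h * (h / 4 * Q p) \<le> r" unfolding r_def using h by (intro mult_left_mono) auto
    then have Qr: "Q p \<le> r" using h by simp
    have x: "norm (fst p i) \<le> norm (xd (real i * h)) + (1 + \<bar>r\<bar>)" if "i \<in> {1..N}" for i
      using square_le_imp_le_1_plus[OF order_trans[OF Qx[OF that] Qr]]
        norm_triangle_ineq2[of "fst p i" "xd (real i * h)"] by linarith
    have u: "norm (snd p i) \<le> norm (ud (real i * h)) + (1 + \<bar>r / \<delta>\<bar>)" if "i \<in> {1..N}" for i
    proof -
      have "(norm (snd p i - ud (real i * h)))\<^sup>2 \<le> r / \<delta>"
        using order_trans[OF Qu[OF that] Qr] \<delta> by (simp add: pos_le_divide_eq mult.commute)
      from square_le_imp_le_1_plus[OF this] show ?thesis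
        using norm_triangle_ineq2[of "snd p i" "ud (real i * h)"] by linarith
    qed
    have "norm (fst (nz p) i) \<le> norm x0 + norm (xd (real i * h)) + (1 + \<bar>r\<bar>)" for i
    proof (cases "i = 0")
      case True
      then have "fst (nz p) i = x0" using p by (simp add: feas nz_def)
      then show ?thesis by (simp add: add_nonneg_nonneg)
    next
      case False
      then have "norm (fst (nz p) i) \<le> norm (xd (real i * h)) + (1 + \<bar>r\<bar>)"
        using x[of i] by (auto simp: nz_def intro!: add_nonneg_nonneg)
      then show ?thesis using norm_ge_zero[of x0] by linarith
    qed
    moreover have "norm (snd (nz p) i) \<le> norm (ud (real i * h)) + (1 + \<bar>r / \<delta>\<bar>)" for i
      using u[of i] by (auto simp: nz_def intro!: add_nonneg_nonneg)
    ultimately show ?thesis unfolding Bx_def by (auto simp: mem_Times_iff)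
  qed
  have "compact Bx" unfolding Bx_def by (intro compact_Times compact_function_box)
  then have "compact (Bx \<inter> {p. feas p})" using \<open>closed {p. feas p}\<close> by (rule compact_Int_closed)
  moreover have "nz p0 \<in> Bx \<inter> {p. feas p}" using inB[of p0] p0 feasnz by (simp add: feas_def)
  ultimately obtain p where p: "p \<in> Bx" "feas p" "\<And>p'. p' \<in> Bx \<Longrightarrow> feas p' \<Longrightarrow> obj p \<le> obj p'"
    using continuous_attains_inf[of "Bx \<inter> {p. feas p}" obj] continuous_on_subset[OF cobj] by blast
  have "obj p \<le> obj p'" if "feas p'" for p'
  proof (cases "obj p' \<le> obj p0")
    case True
    then show ?thesis using p(3)[OF inB[OF that True]] that by (simp add: feasnz objnz)
  next
    case False
    then show ?thesis using p(3)[of "nz p0"] \<open>nz p0 \<in> Bx \<inter> {p. feas p}\<close> by (simp add: objnz)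
  qed
  then have "is_arg_min obj feas p" using p(2) by (auto simp: is_arg_min_def not_less)
  then show ?thesis unfolding time_stepping_optimal_def obj_def feas_def by blast
qed

section \<open>From almost sure properties to the sampled problem\<close>

lemma continuously_differentiable_imp_continuous:
  "continuously_differentiable f \<Longrightarrow> continuous_on UNIV f"
  unfolding continuously_differentiable_def
  by (metis continuous_at_imp_continuous_on has_derivative_continuous)

text \<open>The exceptional null set may depend on the pair, and there are uncountably many pairs. A
  countable dense set of pairs shares one null set; off it, continuity makes the set of good pairs
  closed, hence everything.\<close>

lemma AE_lipschitz_everywhere:
  fixes F :: "'a::euclidean_space \<Rightarrow> 's \<Rightarrow> real"
  assumes lip: "\<And>z1 z2. AE s in M. \<bar>F z1 s - F z2 s\<bar> \<le> \<kappa> s * norm (z1 - z2)"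
    and cont: "AE s in M. continuous_on UNIV (\<lambda>z. F z s)"
  shows "AE s in M. \<forall>z1 z2. \<bar>F z1 s - F z2 s\<bar> \<le> \<kappa> s * norm (z1 - z2)"
proof -
  obtain Q :: "'a set" where Q: "countable Q" "\<And>X. open X \<Longrightarrow> X \<noteq> {} \<Longrightarrow> \<exists>d\<in>Q. d \<in> X"
    using countable_dense_setE by metis
  have dense: "closure Q = UNIV"
    using Q(2)[of "- closure Q"] closure_subset[of Q] by (auto simp: open_closed)
  have "AE s in M. \<forall>p\<in>Q \<times> Q. \<bar>F (fst p) s - F (snd p) s\<bar> \<le> \<kappa> s * norm (fst p - snd p)"
    using Q(1) lip by (subst AE_ball_countable) auto
  then show ?thesis using cont
  proof eventually_elim
    case (elim s)
    define W where "W = {p. \<bar>F (fst p) s - F (snd p) s\<bar> \<le> \<kappa> s * norm (fst p - snd p)}"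
    have "closed W" unfolding W_def
      by (intro closed_Collect_le continuous_intros continuous_on_compose2[OF elim(2)]) auto
    moreover have "Q \<times> Q \<subseteq> W" using elim(1) by (auto simp: W_def)
    ultimately have "closure (Q \<times> Q) \<subseteq> W" by (intro closure_minimal)
    then have "(z1, z2) \<in> W" for z1 z2 by (auto simp: closure_Times dense)
    then show ?case unfolding W_def mem_Collect_eq fst_conv snd_conv by blast
  qed
qed

lemma norm_sample_average_le:
  assumes "\<And>j. j \<ge> 1 \<Longrightarrow> norm (\<phi> (s j)) \<le> \<psi> (s j)"
  shows "norm (sample_average \<nu> s \<phi>) \<le> (sample_average \<nu> s \<psi> :: real)"
  unfolding sample_average_def norm_scaleR
  using assms by (auto intro!: divide_right_mono order_trans[OF norm_sum] sum_mono)

lemma sample_average_diff: "sample_average \<nu> s \<phi> - sample_average \<nu> s \<psi> = sample_average \<nu> s (\<lambda>x. \<phi> x - \<psi> x)"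
  by (simp add: sample_average_def sum_subtractf scaleR_diff_right)

lemma sample_average_cmult: "sample_average \<nu> s (\<lambda>x. \<phi> x * c) = sample_average \<nu> s \<phi> * (c::real)"
  by (simp add: sample_average_def sum_distrib_right)

text \<open>\<open>\<Xi>\<close> is an image and need not be a Borel set, so the values carry the
  trace sigma-algebra. The sample lives on its own space \<open>S\<close>, tied to
  \<open>\<xi>\<close> only through \<open>law\<close>.\<close>

theorem theorem4p1:
  fixes P :: "'w measure" and \<xi> :: "'w \<Rightarrow> real^'d" and \<Xi> :: "(real^'d) set"
    and law :: "(real^'d) measure"
    and S :: "'s measure" and X :: "nat \<Rightarrow> 's \<Rightarrow> real^'d"
    and A :: "real^'n^'n" and B :: "real^'m^'n" and C :: "real^'n^'l" and D :: "real^'m^'l"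
    and x0 :: "real^'n" and f :: "real \<Rightarrow> real^'l" and T \<delta> :: real
    and xd :: "real \<Rightarrow> real^'n" and ud :: "real \<Rightarrow> real^'m"
    and K :: "(real^'p) set"
    and F :: "real^'n \<Rightarrow> real^'d \<Rightarrow> real" and g :: "real^'n \<Rightarrow> real^'d \<Rightarrow> real^'p"
    and M :: "real^'d \<Rightarrow> real^'n^'n" and q :: "real^'d \<Rightarrow> real^'n"
    and \<kappa>1 \<kappa>2 \<kappa>3 \<kappa>4 :: "real^'d \<Rightarrow> real"
    and Y :: "real^'k^'m" and EM :: "real^'n^'n" and Eq :: "real^'n"
  assumes P: "prob_space P" and \<xi>: "\<xi> \<in> measurable P borel"
    and \<Xi>: "\<Xi> = \<xi> ` space P"
    and law: "law = distr P (restrict_space borel \<Xi>) \<xi>"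
    and S: "prob_space S"
    and indep: "prob_space.indep_vars S (\<lambda>_. restrict_space borel \<Xi>) X {1..}"
    and ident: "\<And>j. j \<ge> 1 \<Longrightarrow> distr S (restrict_space borel \<Xi>) (X j) = law"
    and T: "T > 0" and \<delta>: "\<delta> > 0"
    and L2: "square_integrable T f" "square_integrable T xd" "square_integrable T ud"
    and K: "K \<noteq> {}" "closed K" "convex K"
    and F_C1: "AE s in law. continuously_differentiable (\<lambda>z. F z s)"
    and g_C1: "AE s in law. continuously_differentiable (\<lambda>z. g z s)"
    and F_meas: "\<And>z. F z \<in> borel_measurable (restrict_space borel \<Xi>)"
    and g_meas: "\<And>z. g z \<in> borel_measurable (restrict_space borel \<Xi>)"
    and M_meas: "M \<in> borel_measurable (restrict_space borel \<Xi>)"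
    and q_meas: "q \<in> borel_measurable (restrict_space borel \<Xi>)"
    and EM: "EM = (\<integral>\<omega>. M (\<xi> \<omega>) \<partial>P)" and Eq: "Eq = (\<integral>\<omega>. q (\<xi> \<omega>) \<partial>P)"
    \<comment> \<open>(a)\<close>
    and \<kappa>_nonneg: "\<And>s. s \<in> \<Xi> \<Longrightarrow> 0 \<le> \<kappa>1 s \<and> 0 \<le> \<kappa>2 s \<and> 0 \<le> \<kappa>3 s \<and> 0 \<le> \<kappa>4 s"
    and \<kappa>_meas: "\<kappa>1 \<in> borel_measurable (restrict_space borel \<Xi>)"
      "\<kappa>2 \<in> borel_measurable (restrict_space borel \<Xi>)"
      "\<kappa>3 \<in> borel_measurable (restrict_space borel \<Xi>)"
      "\<kappa>4 \<in> borel_measurable (restrict_space borel \<Xi>)"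
    and \<kappa>_int: "integrable P (\<lambda>\<omega>. \<kappa>1 (\<xi> \<omega>))" "integrable P (\<lambda>\<omega>. \<kappa>2 (\<xi> \<omega>))"
      "integrable P (\<lambda>\<omega>. \<kappa>3 (\<xi> \<omega>))" "integrable P (\<lambda>\<omega>. \<kappa>4 (\<xi> \<omega>))"
    and F_lip: "\<And>z1 z2. AE s in law. \<bar>F z1 s - F z2 s\<bar> \<le> \<kappa>1 s * norm (z1 - z2)"
    and g_bound: "\<And>z1. AE s in law. norm (g z1 s) \<le> \<kappa>2 s * norm z1"
    and M_bound: "\<And>s. s \<in> \<Xi> \<Longrightarrow> norm (M s) \<le> \<kappa>3 s"
    and q_bound: "\<And>s. s \<in> \<Xi> \<Longrightarrow> norm (q s) \<le> \<kappa>4 s"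
    \<comment> \<open>(b)\<close>
    and D_rank: "rank D = CARD('l)" and l_less_m: "CARD('l) < CARD('m)"
    and Y_dim: "CARD('k) = CARD('m) - CARD('l)"
    and Y_rank: "rank Y = CARD('k)" and DY: "D ** Y = 0"
    and R_rank: "rank (krylov_matrix (A - B ** pseudoinverse D ** C) (B ** Y)) = CARD('n)"
    \<comment> \<open>(c)\<close>
    and ball: "cball 0 (beta_const EM * (\<integral>\<omega>. \<kappa>2 (\<xi> \<omega>) \<partial>P) * vec_norm1 Eq) \<subseteq> K"
    \<comment> \<open>(d)\<close>
    and V: "{v. (\<integral>\<omega>. M (\<xi> \<omega>) *v v + q (\<xi> \<omega>) \<partial>P) \<ge> 0 \<and> v \<ge> 0} \<noteq> {}"
    \<comment> \<open>(e)\<close>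
    and EM_class: "adequate EM \<or> Z_matrix EM"
    \<comment> \<open>(f)\<close>
    and F_int: "\<And>z. integrable P (\<lambda>\<omega>. F z (\<xi> \<omega>))"
    and F_below: "\<exists>c. \<forall>z. c \<le> (\<integral>\<omega>. F z (\<xi> \<omega>) \<partial>P)"
  shows "\<forall>\<epsilon>>0. AE \<omega> in S. \<exists>\<nu>0 h0. h0 > 0 \<and>
           (\<forall>\<nu>\<ge>\<nu>0. \<forall>N. N > 0 \<and> T / real N \<le> h0 \<longrightarrow>
              (\<exists>xu. time_stepping_optimal A B C D x0 f xd ud \<delta> F M q g K \<epsilon> T N \<nu>
                      (\<lambda>j. X j \<omega>) xu))"
proof -
  interpret P: prob_space P by (rule P)
  define Nm where "Nm = restrict_space borel \<Xi>"
  interpret iid_sample S Nm law X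
    using S indep ident unfolding iid_sample_def iid_sample_axioms_def Nm_def by blast
  have \<xi>_meas: "\<xi> \<in> measurable P Nm"
    unfolding Nm_def using \<xi> by (rule measurable_restrict_space2[rotated]) (auto simp: \<Xi>)
  have space_Nm: "space Nm = \<Xi>" by (simp add: Nm_def space_restrict_space)
  have space_law: "space law = \<Xi>" using law by (simp add: Nm_def[symmetric] space_Nm)
  have \<xi>_in: "\<xi> \<omega> \<in> \<Xi>" if "\<omega> \<in> space P" for \<omega> using that by (simp add: \<Xi>)
  note meas = F_meas g_meas M_meas q_meas \<kappa>_meas
  note meas = meas[folded Nm_def]
  have law': "law = distr P Nm \<xi>" by (simp add: law Nm_def)
  have int_law: "integrable law \<phi> \<longleftrightarrow> integrable P (\<lambda>\<omega>. \<phi> (\<xi> \<omega>))"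
    and integral_law: "(\<integral>s. \<phi> s \<partial>law) = (\<integral>\<omega>. \<phi> (\<xi> \<omega>) \<partial>P)"
    if "\<phi> \<in> borel_measurable Nm" for \<phi> :: "real^'d \<Rightarrow> 'z::euclidean_space"
    unfolding law' using \<xi>_meas that by (simp_all add: integrable_distr_eq integral_distr)
  have intM: "integrable P (\<lambda>\<omega>. M (\<xi> \<omega>))"
  proof (rule Bochner_Integration.integrable_bound[OF \<kappa>_int(3)])
    show "AE \<omega> in P. norm (M (\<xi> \<omega>)) \<le> norm (\<kappa>3 (\<xi> \<omega>))"
      using \<xi>_in M_bound \<kappa>_nonneg by (intro AE_I2) fastforce
  qed (rule measurable_compose[OF \<xi>_meas meas(3)])
  have intq: "integrable P (\<lambda>\<omega>. q (\<xi> \<omega>))"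
  proof (rule Bochner_Integration.integrable_bound[OF \<kappa>_int(4)])
    show "AE \<omega> in P. norm (q (\<xi> \<omega>)) \<le> norm (\<kappa>4 (\<xi> \<omega>))"
      using \<xi>_in q_bound \<kappa>_nonneg by (intro AE_I2) fastforce
  qed (rule measurable_compose[OF \<xi>_meas meas(4)])
  have bl: "bounded_linear (\<lambda>A :: real^'n^'n. A *v v)" for v
    by (intro linear_conv_bounded_linear[THEN iffD1] linearI)
      (simp_all add: matrix_vector_mult_add_rdistrib scaleR_matrix_vector_assoc)
  have intMq: "integrable P (\<lambda>\<omega>. M (\<xi> \<omega>) *v v + q (\<xi> \<omega>))" for v
    by (intro Bochner_Integration.integrable_add integrable_bounded_linear[OF bl] intM intq)
  have EMq: "(\<integral>\<omega>. M (\<xi> \<omega>) *v v + q (\<xi> \<omega>) \<partial>P) = EM *v v + Eq" for v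
    unfolding EM Eq integral_bounded_linear[OF bl intM, symmetric]
    by (intro Bochner_Integration.integral_add integrable_bounded_linear[OF bl] intM intq)
  obtain v where "EM *v v + Eq \<ge> 0" "v \<ge> 0" using V by (auto simp: EMq)
  then obtain x where x: "lcp_solution EM Eq x" "vec_norm1 x \<le> beta_const EM * vec_norm1 Eq"
    using lcp_bounded_solution[OF EM_class, of v Eq] by (auto simp: less_eq_vec_def)
  define \<Phi> where "\<Phi> s = M s *v x + q s" for s
  have \<Phi>_meas: "\<Phi> \<in> borel_measurable Nm" unfolding \<Phi>_def
    by (intro borel_measurable_add meas(4) measurable_compose[OF meas(3)]
        borel_measurable_continuous_onI linear_continuous_on bl)
  have int\<Phi>: "integrable law \<Phi>" "(\<integral>s. \<Phi> s \<partial>law) = EM *v x + Eq"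
    unfolding int_law[OF \<Phi>_meas] integral_law[OF \<Phi>_meas]
    by (simp_all only: \<Phi>_def intMq EMq)
  have int\<kappa>2: "integrable law \<kappa>2" using \<kappa>_int(2) int_law[OF meas(6)] by simp
  have \<kappa>2_nonneg: "AE s in law. 0 \<le> \<kappa>2 s" using \<kappa>_nonneg by (intro AE_I2) (simp add: space_law)
  have gx_meas: "g x \<in> borel_measurable law" using meas(2) by (simp cong: measurable_cong_sets add: law')
  have intg: "integrable law (g x)"
  proof (rule Bochner_Integration.integrable_bound[OF integrable_mult_left[OF int\<kappa>2, of "norm x"]])
    show "AE s in law. norm (g x s) \<le> norm (\<kappa>2 s * norm x)"
      using g_bound[of x] \<kappa>2_nonneg by eventually_elim (simp add: abs_mult)
  qed (rule gx_meas)
  \<comment> \<open>The Euclidean norm of \<open>x\<close> is at most its 1-norm, so the \<beta>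
    bound yields exactly the radius in (c).\<close>
  have "norm (\<integral>s. g x s \<partial>law) \<le> (\<integral>s. norm (g x s) \<partial>law)" by (rule integral_norm_bound)
  also have "\<dots> \<le> (\<integral>s. \<kappa>2 s * norm x \<partial>law)"
    using intg int\<kappa>2 g_bound by (intro integral_mono_AE) auto
  also have "\<dots> = (\<integral>\<omega>. \<kappa>2 (\<xi> \<omega>) \<partial>P) * norm x" by (simp add: integral_law[OF meas(6)])
  also have "\<dots> \<le> (\<integral>\<omega>. \<kappa>2 (\<xi> \<omega>) \<partial>P) * (beta_const EM * vec_norm1 Eq)"
  proof (rule mult_left_mono)
    show "norm x \<le> beta_const EM * vec_norm1 Eq" using x(2) norm_le_vec_norm1 order_trans by blast
    show "0 \<le> (\<integral>\<omega>. \<kappa>2 (\<xi> \<omega>) \<partial>P)"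
      using \<xi>_in \<kappa>_nonneg by (intro integral_nonneg_AE AE_I2) auto
  qed
  finally have gK: "(\<integral>s. g x s \<partial>law) \<in> K"
    using ball by (auto simp: subset_iff mult_ac)
  have F_cont: "AE s in law. continuous_on UNIV (\<lambda>z. F z s)"
    using F_C1 by eventually_elim (rule continuously_differentiable_imp_continuous)
  have g_cont: "AE s in law. continuous_on UNIV (\<lambda>z. g z s)"
    using g_C1 by eventually_elim (rule continuously_differentiable_imp_continuous)
  show ?thesis
  proof (intro allI impI)
    fix \<epsilon> :: real assume \<epsilon>: "\<epsilon> > 0"
    show "AE \<omega> in S. \<exists>\<nu>0 h0. h0 > 0 \<and>
           (\<forall>\<nu>\<ge>\<nu>0. \<forall>N. N > 0 \<and> T / real N \<le> h0 \<longrightarrow>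
              (\<exists>xu. time_stepping_optimal A B C D x0 f xd ud \<delta> F M q g K \<epsilon> T N \<nu>
                      (\<lambda>j. X j \<omega>) xu))"
      \<comment> \<open>All randomness enters through these five almost sure events; once
        \<open>\<omega>\<close> is fixed, the rest is deterministic.\<close>
      using slln_vec[OF \<Phi>_meas int\<Phi>(1)] slln_vec[OF meas(2)[of x] intg]
        AE_sample[OF AE_lipschitz_everywhere[OF F_lip F_cont]] AE_sample[OF F_cont] AE_sample[OF g_cont]
    proof eventually_elim
      case (elim \<omega>)
      let ?s = "\<lambda>j. X j \<omega>"
      have "(\<lambda>\<nu>. norm (vec_min x (sample_average \<nu> ?s \<Phi>))) \<longlonglongrightarrow> norm (vec_min x (EM *v x + Eq))"
        unfolding vec_min_def using elim(1)[unfolded int\<Phi>(2)]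
        by (intro tendsto_norm tendsto_vec_lambda tendsto_min tendsto_const tendsto_vec_nth)
      moreover have "vec_min x (EM *v x + Eq) = 0"
        using x(1) by (auto simp: vec_min_def lcp_solution_def vec_eq_iff min_def
            simp del: vector_add_component) (metis order_antisym)+
      ultimately have "\<forall>\<^sub>F \<nu> in sequentially. norm (vec_min x (sample_average \<nu> ?s \<Phi>)) < \<epsilon>"
        using \<epsilon> by (intro order_tendstoD(2)) auto
      moreover have "(\<lambda>\<nu>. infdist (sample_average \<nu> ?s (g x)) K) \<longlonglongrightarrow> infdist (\<integral>s. g x s \<partial>law) K"
        by (intro tendsto_infdist elim(2))
      then have "\<forall>\<^sub>F \<nu> in sequentially. infdist (sample_average \<nu> ?s (g x)) K < \<epsilon>"
        using \<epsilon> gK by (intro order_tendstoD(2)) auto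
      ultimately obtain \<nu>0 where \<nu>0: "\<And>\<nu>. \<nu> \<ge> \<nu>0 \<Longrightarrow> norm (vec_min x (sample_average \<nu> ?s \<Phi>)) < \<epsilon>"
          "\<And>\<nu>. \<nu> \<ge> \<nu>0 \<Longrightarrow> infdist (sample_average \<nu> ?s (g x)) K < \<epsilon>"
        unfolding eventually_sequentially by (metis linear order_trans)
      \<comment> \<open>T/N \<le> T/n means N \<ge> n, the number of steps that controllability
        requires.\<close>
      show ?case
      proof (intro exI[of _ \<nu>0] exI[of _ "T / real CARD('n)"] conjI allI impI)
        show "T / real CARD('n) > 0" using T by simp
        fix \<nu> N assume \<nu>: "\<nu>0 \<le> \<nu>" and "N > 0 \<and> T / real N \<le> T / real CARD('n)"
        then have N: "N > 0" and hN: "T / real N \<le> T / real CARD('n)" by auto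
        have nN: "CARD('n) \<le> N"
          using hN N T by (simp add: divide_le_cancel frac_le_eq field_simps)
        have h: "T / real N \<noteq> 0" using T N by simp
        obtain y u where yu: "y 0 = x0" "y N = x"
          "\<And>i. i < N \<Longrightarrow> y (Suc i) - y i = (T / real N) *\<^sub>R (A *v y (Suc i)) + (T / real N) *\<^sub>R (B *v u (Suc i))"
          "\<And>i. C *v y i + D *v u i = f (real i * (T / real N))"
          using constrained_implicit_euler_controllable[OF D_rank DY R_rank h nN,
              of x0 x "\<lambda>i. f (real i * (T / real N))"] by metis
        have "time_stepping_feasible A B C D x0 f M q g K \<epsilon> T N \<nu> ?s (y, u)"
          unfolding time_stepping_feasible_def Let_def prod.case
        proof (intro conjI allI impI)
          show "norm (vec_min (y N) (sample_average \<nu> ?s (\<lambda>\<xi>. M \<xi> *v y N + q \<xi>))) \<le> \<epsilon>"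
            using \<nu>0(1)[OF \<nu>] by (simp add: yu(2) \<Phi>_def[abs_def])
          show "infdist (sample_average \<nu> ?s (g (y N))) K \<le> \<epsilon>"
            using \<nu>0(2)[OF \<nu>] by (simp add: yu(2))
          show "C *v y (Suc i) + D *v u (Suc i) - f (real (Suc i) * (T / real N)) \<le> 0" for i
            unfolding yu(4) by simp
        qed (use yu in auto)
        \<comment> \<open>The Lipschitz constant is the sample average of \<open>\<kappa>1\<close>;
          it may vary with \<open>\<nu>\<close> and \<open>\<omega>\<close>, both of which are fixed
          here.\<close>
        moreover have "\<bar>sample_average \<nu> ?s (F z1) - sample_average \<nu> ?s (F z2)\<bar>
            \<le> sample_average \<nu> ?s \<kappa>1 * norm (z1 - z2)" for z1 z2
          unfolding sample_average_diff sample_average_cmult[symmetric] real_norm_def[symmetric]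
          using elim(3) by (intro norm_sample_average_le) simp
        moreover have "continuous_on UNIV (\<lambda>z. sample_average \<nu> ?s (F z))"
          unfolding sample_average_def using elim(4) by (intro continuous_intros) auto
        moreover have "continuous_on UNIV (\<lambda>z. sample_average \<nu> ?s (g z))"
          unfolding sample_average_def using elim(5) by (intro continuous_intros) auto
        ultimately show "\<exists>xu. time_stepping_optimal A B C D x0 f xd ud \<delta> F M q g K \<epsilon> T N \<nu> ?s xu"
          by (intro time_stepping_optimal_exists[OF T \<delta> N])
      qed
    qed
  qed
qed

end
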